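(* Let $\Pi$ be an $\mathsf{LCL}$ problem, and assume that a uniform or a coprime certificate for $O(\log^* n)$ solvability for $\Pi$ exists. Then $\Pi$ can be solved in $O(\log^* n)$ rounds in the $\mathsf{CONGEST}$ model (on $n$-node full $\delta$-ary rooted trees).
   Context: An $\mathsf{LCL}$ problem is a triple $\Pi=(\delta,\Sigma(\Pi),\mathcal C(\Pi))$ where $\delta\ge 1$ is an integer, $\Sigma(\Pi)$ is a finite set of labels, and $\mathcal C(\Pi)\subseteq\Sigma(\Pi)^{\delta+1}$ is a set of allowed configurations, written $(a:b_1,\dots,b_\delta)$; the order of $b_1,\dots,b_\delta$ is irrelevant. Inputs are unlabeled full $\delta$-ary rooted trees (every node has exactly $\delta$ or $0$ children). A labeling $\lambda$ of the nodes of a tree by $\Sigma(\Pi)$ is correct (a solution) if for every node $v$ with $\delta$ children $v_1,\dots,v_\delta$ there is a permutation $\rho$ of $\{1,\dots,\delta\}$ with $(\lambda(v):\lambda(v_{\rho(1)}),\dots,\lambda(v_{\rho(\delta)}))\in\mathcal C(\Pi)$; leaves are unconstrained. A complete $\delta$-ary tree of depth $d$ is one in which every non-leaf has $\delta$ children and all leaves are at distance $d$ from the root. Uniform certificate for $O(\log^* n)$ solvability: a nonempty label set $\Sigma_{\mathcal T}=\{\sigma_1,\dots,\sigma_t\}\subseteq\Sigma(\Pi)$, a depth $d\ge 1$, and labeled trees $\mathcal T_1,\dots,\mathcal T_t$ such that (1) each $\mathcal T_i$ is a complete $\delta$-ary tree of depth $d$; (2) each $\mathcal T_i$ is labeled with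 labels from $\Sigma_{\mathcal T}$ and is correct with respect to $\mathcal C(\Pi)$; (3) the trees obtained from the $\mathcal T_i$ by erasing the labels of all non-leaf nodes are all isomorphic as rooted trees with labeled leaves; (4) the root of $\mathcal T_i$ is labeled $\sigma_i$. Coprime certificate for $O(\log^* n)$ solvability: a nonempty label set $\Sigma_{\mathcal T}=\{\sigma_1,\dots,\sigma_t\}\subseteq\Sigma(\Pi)$, coprime integers $d_1,d_2\ge1$, and two sequences of labeled trees $\mathcal T^1_1,\dots,\mathcal T^1_t$ and $\mathcal T^2_1,\dots,\mathcal T^2_t$ such that for $j\in\{1,2\}$: each $\mathcal T^j_i$ is a complete $\delta$-ary tree of depth $d_j$, labeled with labels from $\Sigma(\Pi)$ correctly with respect to $\mathcal C(\Pi)$, with leaves labeled from $\Sigma_{\mathcal T}$; the trees obtained from $\mathcal T^j_1,\dots,\mathcal T^j_t$ by erasing the labels of all non-leaf nodes are all isomorphic as rooted trees with labeled leaves; and the root of $\mathcal T^j_i$ is labeled $\sigma_i$. Model. In $\mathsf{CONGEST}$ on an $n$-node graph each node has a unique identifier from $\{1,\dots,\mathrm{poly}(n)\}$ and initially knows its identifier, its degree, $n$, the maximum degree, and which incident edge leads to its parent. In synchronous rounds nodes exchange $O(\log n)$-bit messages with neighbors and do unbounded local computation; each node eventually outputs its label. The running time is the number of rounds until all nodes have output. Algorithms are deterministic. *)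

theory Defs
  imports "HOL-Library.Landau_Symbols" "HOL-Computational_Algebra.Polynomial"
begin

section \<open>Rooted trees\<close>

text \<open>Unordered rooted trees, given by parent pointers. The value of \<open>parent\<close> at the root
  and outside \<open>nodes\<close> carries no meaning.\<close>

record 'v rtree =
  nodes :: "'v set"
  tree_root :: 'v
  parent :: "'v \<Rightarrow> 'v"

definition rooted_tree :: "('v, 'm) rtree_scheme \<Rightarrow> bool" where
  "rooted_tree T \<longleftrightarrow>
     finite (nodes T) \<and> tree_root T \<in> nodes T \<and>
     (\<forall>u \<in> nodes T - {tree_root T}. parent T u \<in> nodes T) \<and>
     (\<forall>u \<in> nodes T. \<exists>k. (parent T ^^ k) u = tree_root T)"

definition children :: "('v, 'm) rtree_scheme \<Rightarrow> 'v \<Rightarrow> 'v set" where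
  "children T v = {u \<in> nodes T - {tree_root T}. parent T u = v}"

definition leaves :: "('v, 'm) rtree_scheme \<Rightarrow> 'v set" where
  "leaves T = {v \<in> nodes T. children T v = {}}"

definition node_depth :: "('v, 'm) rtree_scheme \<Rightarrow> 'v \<Rightarrow> nat" where
  "node_depth T v = (LEAST k. (parent T ^^ k) v = tree_root T)"

definition full_tree :: "nat \<Rightarrow> ('v, 'm) rtree_scheme \<Rightarrow> bool" where
  "full_tree \<delta> T \<longleftrightarrow>
     rooted_tree T \<and> (\<forall>v \<in> nodes T. card (children T v) = \<delta> \<or> card (children T v) = 0)"

definition complete_tree :: "nat \<Rightarrow> nat \<Rightarrow> ('v, 'm) rtree_scheme \<Rightarrow> bool" where
  "complete_tree \<delta> d T \<longleftrightarrow>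
     rooted_tree T \<and>
     (\<forall>v \<in> nodes T - leaves T. card (children T v) = \<delta>) \<and>
     (\<forall>v \<in> leaves T. node_depth T v = d)"

definition labeled_tree_iso ::
  "'v rtree \<Rightarrow> ('v \<Rightarrow> 'l) \<Rightarrow> 'w rtree \<Rightarrow> ('w \<Rightarrow> 'l) \<Rightarrow> bool" where
  "labeled_tree_iso T L T' L' \<longleftrightarrow>
     (\<exists>f. bij_betw f (nodes T) (nodes T') \<and>
          f (tree_root T) = tree_root T' \<and>
          (\<forall>u \<in> nodes T - {tree_root T}. parent T' (f u) = f (parent T u)) \<and>
          (\<forall>u \<in> nodes T. L' (f u) = L u))"

definition erase_inner :: "'v rtree \<Rightarrow> ('v \<Rightarrow> 'l) \<Rightarrow> 'v \<Rightarrow> 'l option" where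
  "erase_inner T L v = (if v \<in> leaves T then Some (L v) else None)"


section \<open>LCL problems\<close>

text \<open>A configuration \<open>(a : b\<^sub>1, \<dots>, b\<^sub>\<delta>)\<close> is the pair \<open>(a, [b\<^sub>1, \<dots>, b\<^sub>\<delta>])\<close>; the order
  of the children labels is made irrelevant in \<open>correct_labeling\<close>, by choosing the
  enumeration \<open>vs\<close> of the children freely.\<close>

record 'l lcl =
  arity :: nat
  labels :: "'l set"
  configs :: "('l \<times> 'l list) set"

definition lcl_problem :: "'l lcl \<Rightarrow> bool" where
  "lcl_problem P \<longleftrightarrow>
     arity P \<ge> 1 \<and> finite (labels P) \<and>
     configs P \<subseteq> {(a, bs). a \<in> labels P \<and> length bs = arity P \<and> set bs \<subseteq> labels P}"

definition correct_labeling ::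
  "'l lcl \<Rightarrow> ('v, 'm) rtree_scheme \<Rightarrow> ('v \<Rightarrow> 'l) \<Rightarrow> bool" where
  "correct_labeling P T L \<longleftrightarrow>
     (\<forall>v \<in> nodes T. L v \<in> labels P) \<and>
     (\<forall>v \<in> nodes T. card (children T v) = arity P \<longrightarrow>
        (\<exists>vs. distinct vs \<and> set vs = children T v \<and> (L v, map L vs) \<in> configs P))"


section \<open>Certificates\<close>

text \<open>The trees of a certificate are indexed by the elements of \<open>S\<close> themselves: the tree
  belonging to the label \<open>\<sigma>\<close> is \<open>T \<sigma>\<close>, with labeling \<open>L \<sigma>\<close>. As all trees are finite,
  natural numbers suffice as nodes.\<close>

definition uniform_certificate ::
  "'l lcl \<Rightarrow> 'l set \<Rightarrow> nat \<Rightarrow> ('l \<Rightarrow> nat rtree) \<Rightarrow> ('l \<Rightarrow> nat \<Rightarrow> 'l) \<Rightarrow> bool" where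
  "uniform_certificate P S d T L \<longleftrightarrow>
     S \<noteq> {} \<and> S \<subseteq> labels P \<and> d \<ge> 1 \<and>
     (\<forall>\<sigma> \<in> S.
        complete_tree (arity P) d (T \<sigma>) \<and>
        (\<forall>v \<in> nodes (T \<sigma>). L \<sigma> v \<in> S) \<and>
        correct_labeling P (T \<sigma>) (L \<sigma>) \<and>
        L \<sigma> (tree_root (T \<sigma>)) = \<sigma>) \<and>
     (\<forall>\<sigma> \<in> S. \<forall>\<tau> \<in> S.
        labeled_tree_iso (T \<sigma>) (erase_inner (T \<sigma>) (L \<sigma>)) (T \<tau>) (erase_inner (T \<tau>) (L \<tau>)))"

definition coprime_certificate_part ::
  "'l lcl \<Rightarrow> 'l set \<Rightarrow> nat \<Rightarrow> ('l \<Rightarrow> nat rtree) \<Rightarrow> ('l \<Rightarrow> nat \<Rightarrow> 'l) \<Rightarrow> bool" where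
  "coprime_certificate_part P S d T L \<longleftrightarrow>
     (\<forall>\<sigma> \<in> S.
        complete_tree (arity P) d (T \<sigma>) \<and>
        correct_labeling P (T \<sigma>) (L \<sigma>) \<and>
        (\<forall>v \<in> leaves (T \<sigma>). L \<sigma> v \<in> S) \<and>
        L \<sigma> (tree_root (T \<sigma>)) = \<sigma>) \<and>
     (\<forall>\<sigma> \<in> S. \<forall>\<tau> \<in> S.
        labeled_tree_iso (T \<sigma>) (erase_inner (T \<sigma>) (L \<sigma>)) (T \<tau>) (erase_inner (T \<tau>) (L \<tau>)))"

definition coprime_certificate ::
  "'l lcl \<Rightarrow> 'l set \<Rightarrow> nat \<Rightarrow> nat \<Rightarrow>
    ('l \<Rightarrow> nat rtree) \<Rightarrow> ('l \<Rightarrow> nat \<Rightarrow> 'l) \<Rightarrow>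
    ('l \<Rightarrow> nat rtree) \<Rightarrow> ('l \<Rightarrow> nat \<Rightarrow> 'l) \<Rightarrow> bool" where
  "coprime_certificate P S d1 d2 T1 L1 T2 L2 \<longleftrightarrow>
     S \<noteq> {} \<and> S \<subseteq> labels P \<and> d1 \<ge> 1 \<and> d2 \<ge> 1 \<and> coprime d1 d2 \<and>
     coprime_certificate_part P S d1 T1 L1 \<and>
     coprime_certificate_part P S d2 T2 L2"


section \<open>The CONGEST model on rooted trees\<close>

text \<open>A network is a tree with an identifier for each node and, at each node, an arbitrary
  numbering of the incident edges: \<open>port N v i\<close> is the neighbor of \<open>v\<close> across its \<open>i\<close>-th edge.\<close>

record 'v network = "'v rtree" +
  ident :: "'v \<Rightarrow> nat"
  port :: "'v \<Rightarrow> nat \<Rightarrow> 'v"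

definition neighbors :: "('v, 'm) rtree_scheme \<Rightarrow> 'v \<Rightarrow> 'v set" where
  "neighbors T v = children T v \<union> (if v = tree_root T then {} else {parent T v})"

definition node_degree :: "('v, 'm) rtree_scheme \<Rightarrow> 'v \<Rightarrow> nat" where
  "node_degree T v = card (neighbors T v)"

definition max_degree :: "('v, 'm) rtree_scheme \<Rightarrow> nat" where
  "max_degree T = Max (node_degree T ` nodes T)"

definition valid_network :: "nat poly \<Rightarrow> 'v network \<Rightarrow> bool" where
  "valid_network p N \<longleftrightarrow>
     rooted_tree N \<and>
     inj_on (ident N) (nodes N) \<and> ident N ` nodes N \<subseteq> {1..poly p (card (nodes N))} \<and>
     (\<forall>v \<in> nodes N. bij_betw (port N v) {..<node_degree N v} (neighbors N v))"

definition port_to :: "'v network \<Rightarrow> 'v \<Rightarrow> 'v \<Rightarrow> nat" where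
  "port_to N v u = inv_into {..<node_degree N v} (port N v) u"

record local_input =
  own_id :: nat
  own_degree :: nat
  num_nodes :: nat
  maximum_degree :: nat
  parent_port :: "nat option"

definition initial_knowledge :: "'v network \<Rightarrow> 'v \<Rightarrow> local_input" where
  "initial_knowledge N v =
     \<lparr> own_id = ident N v,
       own_degree = node_degree N v,
       num_nodes = card (nodes N),
       maximum_degree = max_degree N,
       parent_port = (if v = tree_root N then None else Some (port_to N v (parent N v))) \<rparr>"

text \<open>Messages are bit strings. Local computation and memory are unbounded, so without loss of
  generality the state of a node is all it has learned so far: its initial knowledge and, for
  each past round, the list of messages received, indexed by port. A deterministic algorithm is
  a function of this state, giving the message to send through each port and possibly an output.\<close>

type_synonym message = "bool list"
type_synonym local_state = "local_input \<times> message list list"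

record 'l algorithm =
  send :: "local_state \<Rightarrow> nat \<Rightarrow> message"
  out :: "local_state \<Rightarrow> 'l option"

fun received :: "'l algorithm \<Rightarrow> 'v network \<Rightarrow> nat \<Rightarrow> 'v \<Rightarrow> message list list" where
  "received A N 0 v = []"
| "received A N (Suc t) v =
     received A N t v @
     [map (\<lambda>i. let u = port N v i
               in send A (initial_knowledge N u, received A N t u) (port_to N u v))
          [0..<node_degree N v]]"

definition state_after :: "'l algorithm \<Rightarrow> 'v network \<Rightarrow> nat \<Rightarrow> 'v \<Rightarrow> local_state" where
  "state_after A N t v = (initial_knowledge N v, received A N t v)"

text \<open>Outputs are irrevocable: only the first one counts.\<close>

definition output_label :: "'l algorithm \<Rightarrow> 'v network \<Rightarrow> 'v \<Rightarrow> 'l" where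
  "output_label A N v =
     the (out A (state_after A N (LEAST t. out A (state_after A N t v) \<noteq> None) v))"

definition terminates_within :: "'l algorithm \<Rightarrow> 'v network \<Rightarrow> nat \<Rightarrow> bool" where
  "terminates_within A N r \<longleftrightarrow>
     (\<forall>v \<in> nodes N. \<exists>t \<le> r. out A (state_after A N t v) \<noteq> None)"

definition message_size_bounded :: "'l algorithm \<Rightarrow> 'v network \<Rightarrow> nat \<Rightarrow> bool" where
  "message_size_bounded A N b \<longleftrightarrow>
     (\<forall>t. \<forall>v \<in> nodes N. \<forall>i < node_degree N v. length (send A (state_after A N t v) i) \<le> b)"

text \<open>Solvability in \<open>O(f n)\<close> rounds. The polynomial \<open>p\<close> bounding the identifiers is a parameter
  of the model, so it is fixed before the algorithm.\<close>

definition congest_solvable :: "'l lcl \<Rightarrow> (nat \<Rightarrow> real) \<Rightarrow> bool" where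
  "congest_solvable P f \<longleftrightarrow>
     (\<forall>p :: nat poly. \<exists>(A :: 'l algorithm) (rounds :: nat \<Rightarrow> nat) (bits :: nat \<Rightarrow> nat).
        (\<lambda>n. real (rounds n)) \<in> O(f) \<and>
        (\<lambda>n. real (bits n)) \<in> O(\<lambda>n. ln (real n)) \<and>
        (\<forall>N :: nat network.
           valid_network p N \<and> full_tree (arity P) N \<longrightarrow>
             terminates_within A N (rounds (card (nodes N))) \<and>
             message_size_bounded A N (bits (card (nodes N))) \<and>
             correct_labeling P N (output_label A N)))"

definition log_star :: "real \<Rightarrow> nat" where
  "log_star x = (LEAST k. (log 2 ^^ k) x \<le> 1)"

end

theory Submission
  imports Defs "HOL-Combinatorics.List_Permutation" "HOL-Number_Theory.Cong" "HOL-Library.Countable"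
begin

text \<open>A certificate yields, for every large enough depth \<open>k\<close>, complete trees of depth \<open>k\<close> with
  arbitrary root label and the same leaf labels: depths add up by stacking, \<open>d1\<close> and \<open>d2\<close> are
  coprime, and a uniform certificate of depth \<open>d\<close> also gives depth \<open>d + 1\<close>. It thus suffices to cut
  the tree at nodes such that below each of them all paths reach the next cut node after the same
  number \<open>k\<close> of steps, with \<open>k\<close> large but bounded.

  Every node computes Cole-Vishkin colours along the path to the root, once for each stride
  \<open>j = 1, \<dots>, K\<close>. After \<open>log_star n + 1\<close> steps the tuple of these colours is a colouring with
  constantly many colours that separates ancestors at distance at most \<open>K\<close>; its local maxima mark
  nodes at bounded distances larger than \<open>K\<close>. A local maximum is recognised only with the help of
  the path below it, so the descendants of a node may disagree on it; this is repaired by cutting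
  at distance \<open>W\<close> below the marks, where the next mark on the way is visible to all nodes concerned.
  All that is needed is a pipeline passing identifiers and child indices down the tree.\<close>

section \<open>Rooted trees\<close>

lemma node_depth_root [simp]: "node_depth T (tree_root T) = 0"
  unfolding node_depth_def by (rule Least_eq_0) simp

lemma node_depth_parent:
  assumes "rooted_tree T" "u \<in> nodes T" "u \<noteq> tree_root T"
  shows "node_depth T u = Suc (node_depth T (parent T u))"
proof -
  obtain k where "(parent T ^^ k) u = tree_root T"
    using assms by (auto simp: rooted_tree_def)
  then have "(LEAST k. (parent T ^^ k) u = tree_root T)
      = Suc (LEAST k. (parent T ^^ Suc k) u = tree_root T)"
    using assms(3) by (intro Least_Suc) auto
  then show ?thesis
    by (simp add: node_depth_def funpow_swap1)
qed

lemma childrenD: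
  assumes "u \<in> children T v"
  shows "u \<in> nodes T" "u \<noteq> tree_root T" "parent T u = v"
  using assms by (auto simp: children_def)

lemma node_depth_child:
  assumes "rooted_tree T" "u \<in> children T v"
  shows "node_depth T u = Suc (node_depth T v)"
  using node_depth_parent[OF assms(1)] childrenD[OF assms(2)] by simp

lemma finite_children: "rooted_tree T \<Longrightarrow> finite (children T v)"
  by (auto simp: rooted_tree_def children_def)

lemma parent_in_nodes:
  "rooted_tree T \<Longrightarrow> u \<in> nodes T \<Longrightarrow> u \<noteq> tree_root T \<Longrightarrow> parent T u \<in> nodes T"
  by (auto simp: rooted_tree_def)

text \<open>A node of maximal depth is a leaf and thus has depth \<open>d\<close>; hence no node
  lies deeper than \<open>d\<close>, and a node at depth \<open>d\<close> has no child.\<close>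

lemma complete_tree_leaf_iff:
  assumes "complete_tree \<delta> d T" "v \<in> nodes T"
  shows "v \<in> leaves T \<longleftrightarrow> node_depth T v = d"
proof
  assume "v \<in> leaves T"
  then show "node_depth T v = d"
    using assms by (auto simp: complete_tree_def)
next
  assume v: "node_depth T v = d"
  have rt: "rooted_tree T"
    using assms by (simp add: complete_tree_def)
  have fin: "finite (node_depth T ` nodes T)"
    using rt by (simp add: rooted_tree_def)
  have "Max (node_depth T ` nodes T) \<in> node_depth T ` nodes T"
    using fin assms(2) by (intro Max_in) auto
  then obtain m where m: "m \<in> nodes T" "node_depth T m = Max (node_depth T ` nodes T)"
    by auto
  have le: "node_depth T u \<le> node_depth T m" if "u \<in> nodes T" for u
    using that fin m(2) by simp
  have "children T m = {}"
    using le node_depth_child[OF rt] childrenD(1) by fastforce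
  then have "node_depth T m = d"
    using m assms(1) by (auto simp: complete_tree_def leaves_def)
  then have "children T v = {}"
    using le v node_depth_child[OF rt] childrenD(1) by fastforce
  then show "v \<in> leaves T"
    using assms(2) by (simp add: leaves_def)
qed


section \<open>Blocks: labelled complete trees with addressed nodes\<close>

text \<open>The children of the node with address \<open>a\<close> have the addresses \<open>i # a\<close>, so that an
  address lists the child indices from the node upwards.\<close>

definition allowed :: "'l lcl \<Rightarrow> 'l \<Rightarrow> 'l list \<Rightarrow> bool" where
  "allowed P x bs \<longleftrightarrow> (\<exists>cs. mset cs = mset bs \<and> (x, cs) \<in> configs P)"

definition block :: "'l lcl \<Rightarrow> 'l set \<Rightarrow> nat \<Rightarrow> ('l \<Rightarrow> nat list \<Rightarrow> 'l) \<Rightarrow> bool" where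
  "block P S k F \<longleftrightarrow> (\<forall>\<sigma> \<in> S. F \<sigma> [] = \<sigma> \<and>
     (\<forall>a. set a \<subseteq> {..<arity P} \<longrightarrow> length a < k \<longrightarrow>
        allowed P (F \<sigma> a) (map (\<lambda>i. F \<sigma> (i # a)) [0..<arity P])) \<and>
     (\<forall>a. set a \<subseteq> {..<arity P} \<longrightarrow> length a = k \<longrightarrow> F \<sigma> a \<in> S))"

text \<open>Corresponding leaves have equal addresses, so the isomorphism in a certificate becomes
  equality of leaf labels.\<close>

definition uniform_block :: "'l lcl \<Rightarrow> 'l set \<Rightarrow> nat \<Rightarrow> ('l \<Rightarrow> nat list \<Rightarrow> 'l) \<Rightarrow> bool" where
  "uniform_block P S k F \<longleftrightarrow> block P S k F \<and>
     (\<forall>\<sigma> \<in> S. \<forall>\<tau> \<in> S. \<forall>a. set a \<subseteq> {..<arity P} \<longrightarrow> length a = k \<longrightarrow> F \<sigma> a = F \<tau> a)"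

section \<open>Stacking blocks to reach all large depths\<close>

definition stack_blocks ::
  "nat \<Rightarrow> ('l \<Rightarrow> nat list \<Rightarrow> 'l) \<Rightarrow> ('l \<Rightarrow> nat list \<Rightarrow> 'l) \<Rightarrow> 'l \<Rightarrow> nat list \<Rightarrow> 'l" where
  "stack_blocks k F G \<sigma> a = (if length a \<le> k then F \<sigma> a
     else G (F \<sigma> (drop (length a - k) a)) (take (length a - k) a))"

text \<open>Addresses start at the node, so \<open>drop\<close> yields the position of a leaf of the
  upper block and \<open>take\<close> the position below it. At length \<open>k\<close> both
  branches of \<open>stack_blocks\<close> agree because \<open>G\<close> puts the prescribed label
  at its root.\<close>

lemma stack_blocks_lower:
  assumes "block P S k F" "block P S l G" "\<sigma> \<in> S" "set a \<subseteq> {..<arity P}" "k \<le> length a"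
  shows "stack_blocks k F G \<sigma> a
    = G (F \<sigma> (drop (length a - k) a)) (take (length a - k) a)"
proof (cases "length a = k")
  case True
  then have "F \<sigma> a \<in> S"
    using assms by (auto simp: block_def)
  then have "G (F \<sigma> a) [] = F \<sigma> a"
    using assms by (auto simp: block_def)
  then show ?thesis
    using True by (simp add: stack_blocks_def)
next
  case False
  then show ?thesis
    using assms(5) by (simp add: stack_blocks_def)
qed

lemma block_stack:
  assumes F: "block P S k F" and G: "block P S l G"
  shows "block P S (k + l) (stack_blocks k F G)"
  unfolding block_def
proof (intro ballI conjI allI impI)
  fix \<sigma> assume s: "\<sigma> \<in> S"
  then show "stack_blocks k F G \<sigma> [] = \<sigma>"
    using F by (simp add: stack_blocks_def block_def)
  fix a assume a: "set a \<subseteq> {..<arity P}"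
  let ?top = "drop (length a - k) a" and ?low = "take (length a - k) a"
  have sets: "set ?top \<subseteq> {..<arity P}" "set ?low \<subseteq> {..<arity P}"
    using a by (meson set_drop_subset set_take_subset order_trans)+
  have top: "F \<sigma> ?top \<in> S" if "k \<le> length a"
  proof -
    have "length ?top = k"
      using that by simp
    then show ?thesis
      using F s sets(1) by (auto simp: block_def)
  qed
  { assume len: "length a < k + l"
    show "allowed P (stack_blocks k F G \<sigma> a)
        (map (\<lambda>i. stack_blocks k F G \<sigma> (i # a)) [0..<arity P])"
    \<comment> \<open>Children of a node above level \<open>k\<close> are at level \<open>k\<close>
      at most and still read from \<open>F\<close>; from level \<open>k\<close> on, node and
      children are read from the same tree of \<open>G\<close>.\<close>
    proof (cases "length a < k")
      case True
      then show ?thesis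
        using F s a by (simp add: stack_blocks_def block_def)
    next
      case False
      then have k: "k \<le> length a"
        by simp
      have eq: "stack_blocks k F G \<sigma> (i # a) = G (F \<sigma> ?top) (i # ?low)"
        if "i < arity P" for i
        using stack_blocks_lower[OF F G s, of "i # a"] that a k
        by (simp add: Suc_diff_le)
      have "allowed P (G (F \<sigma> ?top) ?low)
          (map (\<lambda>i. G (F \<sigma> ?top) (i # ?low)) [0..<arity P])"
        using G top[OF k] sets(2) len k by (auto simp: block_def)
      moreover have "map (\<lambda>i. G (F \<sigma> ?top) (i # ?low)) [0..<arity P]
          = map (\<lambda>i. stack_blocks k F G \<sigma> (i # a)) [0..<arity P]"
        using eq by simp
      ultimately show ?thesis
        using stack_blocks_lower[OF F G s a k] by simp
    qed }
  { assume len: "length a = k + l"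
    have "G (F \<sigma> ?top) ?low \<in> S"
      using G top sets(2) len by (auto simp: block_def)
    then show "stack_blocks k F G \<sigma> a \<in> S"
      using stack_blocks_lower[OF F G s a] len by simp }
qed

text \<open>Uniformity comes from the upper block: its leaf labels fix which trees of
  \<open>G\<close> hang below, whatever the root label.\<close>

lemma uniform_block_stack:
  assumes F: "uniform_block P S k F" and G: "block P S l G"
  shows "uniform_block P S (k + l) (stack_blocks k F G)"
proof -
  have bF: "block P S k F"
    using F by (simp add: uniform_block_def)
  have "stack_blocks k F G \<sigma> a = stack_blocks k F G \<tau> a"
    if "\<sigma> \<in> S" "\<tau> \<in> S" and a: "set a \<subseteq> {..<arity P}" "length a = k + l" for \<sigma> \<tau> a
  proof -
    have "set (drop (length a - k) a) \<subseteq> {..<arity P}" "length (drop (length a - k) a) = k"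
      using a by (meson set_drop_subset order_trans, simp)
    then have "F \<sigma> (drop (length a - k) a) = F \<tau> (drop (length a - k) a)"
      using F that unfolding uniform_block_def by blast
    then show ?thesis
      using stack_blocks_lower[OF bF G] that by simp
  qed
  then show ?thesis
    using block_stack[OF bF G] unfolding uniform_block_def by blast
qed

lemma uniform_block_multiple:
  assumes "uniform_block P S k F" "m \<ge> 1"
  shows "\<exists>G. uniform_block P S (m * k) G"
  using assms(2)
proof (induction m rule: dec_induct)
  case base
  then show ?case
    using assms(1) by auto
next
  case (step m)
  then obtain G where "uniform_block P S (m * k) G"
    by auto
  then have "uniform_block P S (m * k + k) (stack_blocks (m * k) G F)"
    using uniform_block_stack assms(1) unfolding uniform_block_def by blast
  then show ?case
    by (auto simp: add.commute)
qed

text \<open>Take for \<open>x\<close> the product of \<open>k\<close> and an inverse of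
  \<open>a\<close> modulo \<open>b\<close>, reduced below \<open>b\<close>: then
  \<open>a * x\<close> is at most \<open>a * b\<close>, and \<open>b\<close> divides
  \<open>k - a * x\<close>.\<close>

lemma coprime_combination:
  assumes "coprime (a :: nat) b" "a \<ge> 1" "b \<ge> 1" "a * b \<le> k"
  shows "\<exists>x y. k = x * a + y * b"
proof -
  obtain x0 where x0: "[a * x0 = k] (mod b)"
  proof -
    obtain x where "[a * x = 1] (mod b)"
      using cong_solve_coprime_nat[OF assms(1)] by auto
    then have "[a * x * k = 1 * k] (mod b)"
      by (rule cong_scalar_right)
    then show thesis
      using that[of "x * k"] by (simp add: mult.assoc)
  qed
  define x where "x = x0 mod b"
  have "[a * x = k] (mod b)"
    using x0 unfolding x_def by (simp add: cong_def mod_mult_right_eq)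
  moreover have "a * x \<le> k"
  proof -
    have "x \<le> b"
      using assms(3) by (simp add: x_def less_imp_le)
    then show ?thesis
      using assms(4) mult_le_mono2 order_trans by blast
  qed
  ultimately have "b dvd k - a * x"
    by (metis cong_altdef_nat cong_sym)
  then obtain y where "k - a * x = b * y" ..
  then have "k = x * a + y * b"
    using \<open>a * x \<le> k\<close> by (simp add: mult.commute)
  then show ?thesis
    by blast
qed

text \<open>A block of depth \<open>0\<close> is uniform only for a single label, so multiples start
  at one copy and combinations with a zero coefficient are treated separately.\<close>

lemma uniform_block_large:
  assumes "uniform_block P S d1 F1" "uniform_block P S d2 F2"
    and "coprime d1 d2" "d1 \<ge> 1" "d2 \<ge> 1" "d1 * d2 \<le> k"
  shows "\<exists>F. uniform_block P S k F"
proof -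
  obtain x y where k: "k = x * d1 + y * d2"
    using coprime_combination assms(3-6) by blast
  have "k \<ge> 1"
    using mult_le_mono[OF assms(4,5)] assms(6) by linarith
  consider "x = 0" "y \<ge> 1" | "y = 0" "x \<ge> 1" | "x \<ge> 1" "y \<ge> 1"
    using \<open>k \<ge> 1\<close> k by (cases "x = 0"; cases "y = 0") auto
  then show ?thesis
  proof cases
    case 3
    obtain G1 G2 where "uniform_block P S (x * d1) G1" "uniform_block P S (y * d2) G2"
      using uniform_block_multiple assms(1,2) 3 by metis
    then show ?thesis
      using uniform_block_stack k by (metis uniform_block_def)
  qed (use uniform_block_multiple assms(1,2) k in force)+
qed


subsection \<open>Blocks from certificates\<close>

definition child_list :: "('v, 'm) rtree_scheme \<Rightarrow> 'v \<Rightarrow> 'v list" where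
  "child_list T v = (SOME vs. distinct vs \<and> set vs = children T v)"

lemma child_list:
  assumes "rooted_tree T"
  shows "distinct (child_list T v)" "set (child_list T v) = children T v"
    "length (child_list T v) = card (children T v)"
proof -
  have "distinct (child_list T v) \<and> set (child_list T v) = children T v"
    unfolding child_list_def
    by (rule someI_ex) (metis finite_distinct_list finite_children[OF assms])
  then show "distinct (child_list T v)" "set (child_list T v) = children T v"
    by auto
  then show "length (child_list T v) = card (children T v)"
    by (metis distinct_card)
qed

primrec node_at :: "('v, 'm) rtree_scheme \<Rightarrow> nat list \<Rightarrow> 'v" where
  "node_at T [] = tree_root T"
| "node_at T (i # a) = child_list T (node_at T a) ! i"

lemma complete_tree_card_children:
  assumes "complete_tree \<delta> d T" "v \<in> nodes T" "node_depth T v < d"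
  shows "card (children T v) = \<delta>"
  using assms complete_tree_leaf_iff[OF assms(1,2)] by (auto simp: complete_tree_def)

lemma node_at:
  assumes "complete_tree \<delta> d T" "set a \<subseteq> {..<\<delta>}" "length a \<le> d"
  shows "node_at T a \<in> nodes T \<and> node_depth T (node_at T a) = length a"
  using assms(2,3)
proof (induction a)
  case Nil
  then show ?case
    using assms(1) by (auto simp: complete_tree_def rooted_tree_def)
next
  case (Cons i a)
  have rt: "rooted_tree T"
    using assms(1) by (simp add: complete_tree_def)
  have IH: "node_at T a \<in> nodes T" "node_depth T (node_at T a) = length a"
    using Cons by auto
  have "card (children T (node_at T a)) = \<delta>"
    using complete_tree_card_children[OF assms(1)] IH Cons.prems by simp
  then have "node_at T (i # a) \<in> children T (node_at T a)"
    using child_list[OF rt, of "node_at T a"] Cons.prems nth_mem[of i "child_list T (node_at T a)"]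
    by simp
  then show ?case
    using childrenD node_depth_child[OF rt] IH by (metis length_Cons)
qed

lemma labeled_tree_iso_children:
  assumes "bij_betw f (nodes T) (nodes T')" "f (tree_root T) = tree_root T'"
    and "\<forall>u \<in> nodes T - {tree_root T}. parent T' (f u) = f (parent T u)"
    and "rooted_tree T" "rooted_tree T'" "v \<in> nodes T"
  shows "f ` children T v = children T' (f v)"
proof
  show "f ` children T v \<subseteq> children T' (f v)"
  proof
    fix w assume "w \<in> f ` children T v"
    then obtain u where u: "u \<in> children T v" "w = f u"
      by auto
    note cu = childrenD[OF u(1)]
    have "w \<in> nodes T'"
      using assms(1) cu u by (auto simp: bij_betw_def)
    moreover have "w \<noteq> tree_root T'"
      using assms(1,2,4) cu u by (auto simp: bij_betw_def inj_on_def rooted_tree_def)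
    ultimately show "w \<in> children T' (f v)"
      using assms(3) cu u by (auto simp: children_def)
  qed
  show "children T' (f v) \<subseteq> f ` children T v"
  proof
    fix w assume "w \<in> children T' (f v)"
    note cw = childrenD[OF this]
    obtain u where u: "u \<in> nodes T" "w = f u"
      using cw assms(1) by (auto simp: bij_betw_def)
    have "u \<noteq> tree_root T"
      using cw u assms(2) by auto
    moreover have "parent T u = v"
    proof -
      have "f (parent T u) = f v"
        using assms(3) cw u \<open>u \<noteq> tree_root T\<close> by auto
      then show ?thesis
        using assms(1,4,6) parent_in_nodes[OF assms(4) u(1)] \<open>u \<noteq> tree_root T\<close>
        by (auto simp: bij_betw_def inj_on_def)
    qed
    ultimately show "w \<in> f ` children T v"
      using u by (auto simp: children_def)
  qed
qed

text \<open>All trees are addressed through one reference tree \<open>T0\<close> and the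
  isomorphisms from it. The second conclusion preserves the fact that a uniform certificate has
  labels in \<open>S\<close> at inner nodes too.\<close>

lemma uniform_block_of_certificate:
  assumes cert: "coprime_certificate_part P S d T L" and "S \<noteq> {}"
  shows "\<exists>F. uniform_block P S d F \<and>
    (\<forall>\<sigma> \<in> S. \<forall>a. set a \<subseteq> {..<arity P} \<longrightarrow> length a \<le> d \<longrightarrow> F \<sigma> a \<in> L \<sigma> ` nodes (T \<sigma>))"
proof -
  let ?\<delta> = "arity P"
  obtain \<sigma>0 where s0: "\<sigma>0 \<in> S"
    using assms(2) by auto
  define T0 where "T0 = T \<sigma>0"
  have ct: "complete_tree ?\<delta> d (T \<sigma>)" "rooted_tree (T \<sigma>)" if "\<sigma> \<in> S" for \<sigma>
    using cert that by (auto simp: coprime_certificate_part_def complete_tree_def)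
  have "\<forall>\<sigma> \<in> S. \<exists>f. bij_betw f (nodes T0) (nodes (T \<sigma>)) \<and>
      f (tree_root T0) = tree_root (T \<sigma>) \<and>
      (\<forall>u \<in> nodes T0 - {tree_root T0}. parent (T \<sigma>) (f u) = f (parent T0 u)) \<and>
      (\<forall>u \<in> nodes T0. erase_inner (T \<sigma>) (L \<sigma>) (f u) = erase_inner T0 (L \<sigma>0) u)"
    using cert s0 unfolding coprime_certificate_part_def labeled_tree_iso_def T0_def by blast
  then obtain f where
    f: "\<And>\<sigma>. \<sigma> \<in> S \<Longrightarrow> bij_betw (f \<sigma>) (nodes T0) (nodes (T \<sigma>))"
      "\<And>\<sigma>. \<sigma> \<in> S \<Longrightarrow> f \<sigma> (tree_root T0) = tree_root (T \<sigma>)"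
      "\<And>\<sigma>. \<sigma> \<in> S \<Longrightarrow> \<forall>u \<in> nodes T0 - {tree_root T0}. parent (T \<sigma>) (f \<sigma> u) = f \<sigma> (parent T0 u)"
      "\<And>\<sigma> u. \<sigma> \<in> S \<Longrightarrow> u \<in> nodes T0 \<Longrightarrow>
        erase_inner (T \<sigma>) (L \<sigma>) (f \<sigma> u) = erase_inner T0 (L \<sigma>0) u"
    by metis
  define F where "F = (\<lambda>\<sigma> a. L \<sigma> (f \<sigma> (node_at T0 a)))"
  have ct0: "complete_tree ?\<delta> d T0" "rooted_tree T0"
    using ct s0 by (auto simp: T0_def)
  have leaf: "f \<sigma> (node_at T0 a) \<in> leaves (T \<sigma>) \<and> F \<sigma> a = L \<sigma>0 (node_at T0 a)"
    if "\<sigma> \<in> S" "set a \<subseteq> {..<?\<delta>}" "length a = d" for \<sigma> a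
  proof -
    have "node_at T0 a \<in> nodes T0" "node_at T0 a \<in> leaves T0"
      using node_at[OF ct0(1)] complete_tree_leaf_iff[OF ct0(1)] that by auto
    then have "erase_inner (T \<sigma>) (L \<sigma>) (f \<sigma> (node_at T0 a)) = Some (L \<sigma>0 (node_at T0 a))"
      using f(4) that by (simp add: erase_inner_def)
    then show ?thesis
      by (auto simp: erase_inner_def F_def split: if_splits)
  qed
  have range: "F \<sigma> a \<in> L \<sigma> ` nodes (T \<sigma>)"
    if "\<sigma> \<in> S" "set a \<subseteq> {..<?\<delta>}" "length a \<le> d" for \<sigma> a
    using node_at[OF ct0(1) that(2,3)] bij_betw_imp_surj_on[OF f(1)[OF that(1)]]
    by (auto simp: F_def)
  have "block P S d F"
    unfolding block_def
  proof (intro ballI conjI allI impI)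
    fix \<sigma> assume s: "\<sigma> \<in> S"
    show "F \<sigma> [] = \<sigma>"
      using cert s f(2) by (simp add: F_def coprime_certificate_part_def)
    fix a assume a: "set a \<subseteq> {..<?\<delta>}"
    { assume len: "length a < d"
      let ?v = "node_at T0 a"
      have v: "?v \<in> nodes T0" "node_depth T0 ?v = length a"
        using node_at[OF ct0(1) a] len by auto
      have card0: "card (children T0 ?v) = ?\<delta>"
        using complete_tree_card_children[OF ct0(1)] v len by simp
      have ch: "f \<sigma> ` children T0 ?v = children (T \<sigma>) (f \<sigma> ?v)"
        by (rule labeled_tree_iso_children[OF f(1-3)[OF s] ct0(2) ct(2)[OF s] v(1)])
      have inj: "inj_on (f \<sigma>) (children T0 ?v)"
        using f(1)[OF s] childrenD(1) by (metis bij_betw_def inj_on_subset subsetI)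
      have "card (children (T \<sigma>) (f \<sigma> ?v)) = ?\<delta>"
        using card0 card_image[OF inj] ch by simp
      moreover have "f \<sigma> ?v \<in> nodes (T \<sigma>)"
        using f(1)[OF s] v(1) by (auto simp: bij_betw_def)
      moreover have "correct_labeling P (T \<sigma>) (L \<sigma>)"
        using cert s by (simp add: coprime_certificate_part_def)
      ultimately obtain vs where vs: "distinct vs" "set vs = children (T \<sigma>) (f \<sigma> ?v)"
        "(L \<sigma> (f \<sigma> ?v), map (L \<sigma>) vs) \<in> configs P"
        by (auto simp: correct_labeling_def)
      let ?us = "child_list T0 ?v"
      note us = child_list[OF ct0(2), of ?v]
      \<comment> \<open>The two lists may enumerate the same children in different orders.\<close>
      have "mset vs = mset (map (f \<sigma>) ?us)"
        using us vs(1,2) inj ch by (intro set_eq_iff_mset_eq_distinct[THEN iffD1]) (auto simp: distinct_map)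
      then have "mset (map (L \<sigma>) vs) = mset (map (L \<sigma>) (map (f \<sigma>) ?us))"
        by (metis mset_map)
      moreover have "map (\<lambda>i. F \<sigma> (i # a)) [0..<?\<delta>] = map (L \<sigma>) (map (f \<sigma>) ?us)"
        using us(3) card0 by (intro nth_equalityI) (auto simp: F_def)
      ultimately have "mset (map (L \<sigma>) vs) = mset (map (\<lambda>i. F \<sigma> (i # a)) [0..<?\<delta>])"
        by simp
      then show "allowed P (F \<sigma> a) (map (\<lambda>i. F \<sigma> (i # a)) [0..<?\<delta>])"
        unfolding allowed_def using vs(3) by (intro exI[of _ "map (L \<sigma>) vs"]) (simp add: F_def) }
    { assume "length a = d"
      then have "f \<sigma> (node_at T0 a) \<in> leaves (T \<sigma>)"
        using leaf[OF s a] by simp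
      then have "L \<sigma> (f \<sigma> (node_at T0 a)) \<in> S"
        using cert s by (simp add: coprime_certificate_part_def)
      then show "F \<sigma> a \<in> S"
        by (simp add: F_def) }
  qed
  then have "uniform_block P S d F"
    using leaf by (simp add: uniform_block_def)
  then show ?thesis
    using range by blast
qed

lemma uniform_blocks_exist:
  assumes "lcl_problem P"
    and "(\<exists>S d T L. uniform_certificate P S d T L) \<or>
         (\<exists>S d1 d2 T1 L1 T2 L2. coprime_certificate P S d1 d2 T1 L1 T2 L2)"
  obtains S K F where "S \<noteq> {}" "S \<subseteq> labels P" "K \<ge> 1"
    "\<And>k. K \<le> k \<Longrightarrow> uniform_block P S k (F k)"
proof -
  obtain S d1 d2 F1 F2 where S: "S \<noteq> {}" "S \<subseteq> labels P"
    and d: "d1 \<ge> 1" "d2 \<ge> 1" "coprime d1 d2"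
    and F: "uniform_block P S d1 F1" "uniform_block P S d2 F2"
    using assms(2)
  proof (elim disjE exE)
    fix S d T L assume c: "uniform_certificate P S d T L"
    then have S: "S \<noteq> {}" "S \<subseteq> labels P" "d \<ge> 1"
      by (auto simp: uniform_certificate_def)
    have "coprime_certificate_part P S d T L"
      using c by (auto simp: uniform_certificate_def coprime_certificate_part_def leaves_def)
    then obtain F where F: "uniform_block P S d F"
      "\<forall>\<sigma> \<in> S. \<forall>a. set a \<subseteq> {..<arity P} \<longrightarrow> length a \<le> d \<longrightarrow> F \<sigma> a \<in> L \<sigma> ` nodes (T \<sigma>)"
      using uniform_block_of_certificate S(1) by blast
    \<comment> \<open>Inner labels also lie in \<open>S\<close>, so cutting \<open>F\<close> off
      after its first level gives a block of depth \<open>1\<close>.\<close>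
    have "F \<sigma> a \<in> S" if "\<sigma> \<in> S" "set a \<subseteq> {..<arity P}" "length a = 1" for \<sigma> a
      using F(2) that c S(3) by (fastforce simp: uniform_certificate_def)
    moreover have "F \<sigma> [] = \<sigma>" "allowed P (F \<sigma> []) (map (\<lambda>i. F \<sigma> [i]) [0..<arity P])"
      if "\<sigma> \<in> S" for \<sigma>
    proof -
      have "F \<sigma> [] = \<sigma>"
        and *: "\<forall>a. set a \<subseteq> {..<arity P} \<longrightarrow> length a < d \<longrightarrow>
          allowed P (F \<sigma> a) (map (\<lambda>i. F \<sigma> (i # a)) [0..<arity P])"
        using F(1)[unfolded uniform_block_def, THEN conjunct1] that by (simp_all add: block_def)
      then show "F \<sigma> [] = \<sigma>" "allowed P (F \<sigma> []) (map (\<lambda>i. F \<sigma> [i]) [0..<arity P])"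
        using *[rule_format, of "[]"] S(3) by simp_all
    qed
    ultimately have "block P S 1 F"
      by (auto simp: block_def)
    \<comment> \<open>With the uniform block on top the result is uniform, and its depth
      \<open>d + 1\<close> is coprime to \<open>d\<close>.\<close>
    then have "uniform_block P S (d + 1) (stack_blocks d F F)"
      using F(1) by (rule uniform_block_stack[rotated])
    then show thesis
      using that[of S d "d + 1"] S F(1) by simp
  next
    fix S d1 d2 T1 L1 T2 L2
    assume "coprime_certificate P S d1 d2 T1 L1 T2 L2"
    then show thesis
      using that uniform_block_of_certificate by (metis coprime_certificate_def)
  qed
  have "\<exists>F. \<forall>k. d1 * d2 \<le> k \<longrightarrow> uniform_block P S k (F k)"
    using uniform_block_large[OF F d(3,1,2)] by metis
  then show ?thesis
    using that[of S "d1 * d2"] S mult_le_mono[OF d(1,2)] by auto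
qed

lemma block_labels:
  assumes "lcl_problem P" "S \<subseteq> labels P" "block P S k F" "\<sigma> \<in> S"
    "set a \<subseteq> {..<arity P}" "length a \<le> k"
  shows "F \<sigma> a \<in> labels P"
proof (cases "length a = k")
  case True
  then show ?thesis
    using assms by (auto simp: block_def)
next
  case False
  then have "allowed P (F \<sigma> a) (map (\<lambda>i. F \<sigma> (i # a)) [0..<arity P])"
    using assms by (auto simp: block_def)
  then show ?thesis
    using assms(1) by (auto simp: allowed_def lcl_problem_def)
qed

text \<open>Labels may repeat, so the permutation found for the labels is applied to the children
  themselves; this gives the enumeration required by \<open>correct_labeling\<close>.\<close>

lemma allowed_map_distinct:
  assumes "allowed P x (map f us)" "distinct us"
  shows "\<exists>vs. distinct vs \<and> set vs = set us \<and> (x, map f vs) \<in> configs P"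
proof -
  obtain cs where cs: "mset cs = mset (map f us)" "(x, cs) \<in> configs P"
    using assms(1) by (auto simp: allowed_def)
  obtain \<pi> where \<pi>: "\<pi> permutes {..<length (map f us)}" "permute_list \<pi> (map f us) = cs"
    using mset_eq_permutation[OF cs(1)] by blast
  then have "cs = map f (permute_list \<pi> us)"
    by (simp add: permute_list_map)
  moreover have "distinct (permute_list \<pi> us)" "set (permute_list \<pi> us) = set us"
    using \<pi>(1) assms(2) by auto
  ultimately show ?thesis
    using cs(2) by blast
qed


section \<open>Colour reduction along the ancestors\<close>

text \<open>The step of Cole and Vishkin: the position of the lowest bit in which \<open>x\<close> differs from
  \<open>y\<close>, together with the value of that bit in \<open>x\<close>.\<close>

definition cv :: "nat \<Rightarrow> nat \<Rightarrow> nat" where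
  "cv x y = (let i = (LEAST i. bit x i \<noteq> bit y i) in 2 * i + of_bool (bit x i))"

lemma differing_bit:
  assumes "(x :: nat) \<noteq> y"
  shows "bit x (LEAST i. bit x i \<noteq> bit y i) \<noteq> bit y (LEAST i. bit x i \<noteq> bit y i)"
proof -
  have "\<exists>i. bit x i \<noteq> bit y i"
    using assms bit_eq_iff by blast
  then show ?thesis
    by (rule LeastI_ex)
qed

text \<open>Equal values would mean the same position \<open>?i\<close> for both pairs and the same
  bit of \<open>x\<close> and \<open>y\<close> there, although \<open>x\<close> and \<open>y\<close>
  differ at \<open>?i\<close>.\<close>

lemma cv_neq:
  assumes "x \<noteq> y" "y \<noteq> z"
  shows "cv x y \<noteq> cv y z"
proof
  let ?i = "LEAST i. bit x i \<noteq> bit y i" and ?j = "LEAST i. bit y i \<noteq> bit z i"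
  assume "cv x y = cv y z"
  then have eq: "2 * ?i + of_bool (bit x ?i) = 2 * ?j + of_bool (bit y ?j)"
    by (simp add: cv_def Let_def)
  have "i = j \<and> a = b" if "2 * i + of_bool a = 2 * j + (of_bool b :: nat)" for i j a b
    using that by (cases a; cases b; simp add: Suc_double_not_eq_double double_not_eq_Suc_double)
  from this[OF eq] have "?i = ?j" "bit x ?i = bit y ?j"
    by blast+
  then have "bit x ?i = bit y ?i"
    by metis
  then show False
    using differing_bit[OF assms(1)] by simp
qed

text \<open>The lowest differing bit is set in \<open>x\<close> or in \<open>y\<close>, so its
  position is at most \<open>log 2 X\<close>.\<close>

lemma cv_le:
  assumes "x \<noteq> y" "real x \<le> X" "real y \<le> X"
  shows "real (cv x y) \<le> 2 * log 2 X + 1"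
proof -
  let ?i = "LEAST i. bit x i \<noteq> bit y i"
  have pow: "2 ^ n \<le> z" if "bit z n" for z n :: nat
  proof (rule ccontr)
    assume "\<not> 2 ^ n \<le> z"
    then show False
      using that by (simp add: bit_iff_odd)
  qed
  have "2 ^ ?i \<le> x \<or> 2 ^ ?i \<le> y"
    using differing_bit[OF assms(1)] pow by blast
  then have "real (2 ^ ?i) \<le> X"
    using assms(2,3) of_nat_mono order_trans by blast
  then have "2 powr real ?i \<le> X"
    by (simp add: powr_realpow)
  then have "real ?i \<le> log 2 X"
    by (subst le_log_iff) (auto intro: less_le_trans[of _ "2 powr real ?i"])
  moreover have "real (cv x y) \<le> 2 * real ?i + 1"
    by (simp add: cv_def Let_def)
  ultimately show ?thesis
    by linarith
qed

text \<open>\<open>x\<close> lists identifiers upwards from the observing node; stride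
  \<open>j\<close> compares position \<open>i\<close> with the one \<open>j\<close> levels further
  up.\<close>

primrec colour :: "nat \<Rightarrow> nat \<Rightarrow> (nat \<Rightarrow> nat) \<Rightarrow> nat \<Rightarrow> nat" where
  "colour j 0 x i = x i"
| "colour j (Suc t) x i = cv (colour j t x i) (colour j t x (i + j))"

lemma colour_Suc_index: "colour j t x (Suc i) = colour j t (\<lambda>i. x (Suc i)) i"
  by (induction t arbitrary: i) simp_all

lemma colour_cong:
  assumes "\<And>l. l \<le> i + j * t \<Longrightarrow> x l = x' l"
  shows "colour j t x i = colour j t x' i"
  using assms
proof (induction t arbitrary: i)
  case (Suc t)
  have "colour j t x i = colour j t x' i"
    using Suc.prems by (intro Suc.IH) simp
  moreover have "colour j t x (i + j) = colour j t x' (i + j)"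
    using Suc.prems by (intro Suc.IH) simp
  ultimately show ?case
    by simp
qed simp

lemma colour_neq:
  assumes "\<And>i. x i \<noteq> x (i + j)"
  shows "colour j t x i \<noteq> colour j t x (i + j)"
  using assms by (induction t arbitrary: i) (simp_all add: cv_neq)


subsection \<open>Iterated logarithms\<close>

lemma log2_le_minus_1:
  assumes "2 \<le> (x :: real)"
  shows "log 2 x \<le> x - 1"
proof -
  have "log 2 x = 1 + log 2 (x / 2)"
    using assms by (simp add: log_divide)
  moreover have "log 2 (x / 2) \<le> (x / 2 - 1) / ln 2"
    using assms ln_le_minus_one[of "x / 2"] by (simp add: log_def divide_right_mono)
  \<comment> \<open>\<open>ln 2\<close> is at least \<open>1 / 2\<close>, by
    \<open>ln y \<le> y - 1\<close> at \<open>y = 1 / 2\<close>.\<close>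
  moreover have "(x / 2 - 1) / ln 2 \<le> (x / 2 - 1) / (1 / 2)"
    using assms ln_le_minus_one[of "1 / 2 :: real"] by (intro divide_left_mono) (auto simp: ln_div)
  ultimately show ?thesis
    by simp
qed

text \<open>Ensures that the \<open>LEAST\<close> in \<open>log_star\<close> is attained: from
  \<open>2\<close> on each logarithm subtracts at least \<open>1\<close>, and between
  \<open>1\<close> and \<open>2\<close> one more suffices.\<close>

lemma iterated_log_le_1: "\<exists>k. (log 2 ^^ k) x \<le> 1"
proof -
  have "x \<le> real m + 1 \<Longrightarrow> \<exists>k. (log 2 ^^ k) x \<le> 1" for m
  proof (induction m arbitrary: x)
    case 0
    then have "(log 2 ^^ 0) x \<le> 1"
      by simp
    then show ?case
      by blast
  next
    case (Suc m)
    consider "x \<le> 1" | "1 < x" "x < 2" | "2 \<le> x"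
      by linarith
    then show ?case
    proof cases
      case 1
      then have "(log 2 ^^ 0) x \<le> 1"
        by simp
      then show ?thesis
        by blast
    next
      case 2
      then have "(log 2 ^^ 1) x \<le> 1"
        by simp
      then show ?thesis
        by blast
    next
      case 3
      then have "log 2 x \<le> real m + 1"
        using log2_le_minus_1[OF 3] Suc.prems by simp
      then obtain k where "(log 2 ^^ k) (log 2 x) \<le> 1"
        using Suc.IH by blast
      then have "(log 2 ^^ Suc k) x \<le> 1"
        by (simp add: funpow_swap1)
      then show ?thesis
        by blast
    qed
  qed
  moreover have "x \<le> real (nat \<lceil>x\<rceil>) + 1"
    by linarith
  ultimately show ?thesis
    by blast
qed

lemma iterated_log_log_star: "(log 2 ^^ log_star x) x \<le> 1"
  unfolding log_star_def by (rule LeastI_ex) (rule iterated_log_le_1)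

lemma iterated_log_gt_1: "t < log_star x \<Longrightarrow> 1 < (log 2 ^^ t) x"
  unfolding log_star_def using not_less_Least by fastforce

lemma log_star_ge_1:
  assumes "1 < x"
  shows "1 \<le> log_star x"
proof (rule ccontr)
  assume "\<not> 1 \<le> log_star x"
  then show False
    using iterated_log_log_star[of x] assms by (cases "log_star x") auto
qed

text \<open>From \<open>log 2 A \<le> A / 8 + 2\<close> the left side is at most
  \<open>A / 4 + 7\<close>. This lets the factor \<open>A\<close> in \<open>colour_bound\<close>
  reproduce itself at each step.\<close>

lemma twice_log2_add_3:
  assumes "16 \<le> (A :: real)"
  shows "2 * log 2 A + 3 \<le> A"
proof -
  have "log 2 (A / 8) \<le> A / 8 - 1"
    using assms by (intro log2_le_minus_1) simp
  moreover have "log 2 (A / 8) = log 2 A - 3"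
    using assms log_of_power_eq[of 8 2 3] by (simp add: log_divide)
  ultimately show ?thesis
    using assms by linarith
qed

text \<open>The first step brings the colours from \<open>X\<close> down to order \<open>r\<close>;
  afterwards each step takes one logarithm of \<open>r\<close> while the factor \<open>A\<close>
  stays. The \<open>max\<close> covers the end, where the iterated logarithm falls to
  \<open>1\<close> or below.\<close>

lemma colour_bound:
  assumes neq: "\<And>i. x i \<noteq> x (i + j)" and X: "\<And>i. real (x i) \<le> X"
    and A: "16 \<le> A" "2 * log 2 X + 1 \<le> A * r"
    and t: "t \<le> log_star r"
  shows "real (colour j (Suc t) x i) \<le> A * max 1 ((log 2 ^^ t) r)"
  using t
proof (induction t arbitrary: i)
  case 0
  have "real (colour j (Suc 0) x i) \<le> 2 * log 2 X + 1"
    using neq X by (simp add: cv_le)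
  also have "\<dots> \<le> A * max 1 r"
    using A order_trans[OF A(2)] by (simp add: mult_left_mono)
  finally show ?case
    by simp
next
  case (Suc t)
  let ?w = "(log 2 ^^ t) r"
  let ?m = "max 1 (log 2 ?w)"
  have w: "1 < ?w"
    using iterated_log_gt_1 Suc.prems by simp
  have "real (colour j (Suc (Suc t)) x i) \<le> 2 * log 2 (A * ?w) + 1"
  proof -
    have "real (colour j (Suc t) x l) \<le> A * ?w" for l
      using Suc.IH[of l] Suc.prems w by simp
    moreover have "colour j (Suc t) x i \<noteq> colour j (Suc t) x (i + j)"
      using neq by (rule colour_neq)
    ultimately show ?thesis
      unfolding colour.simps(2)[of j "Suc t"] by (intro cv_le)
  qed
  also have "\<dots> = 2 * log 2 A + 2 * log 2 ?w + 1"
    using A(1) w by (simp add: log_mult)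
  \<comment> \<open>The terms \<open>2 * log 2 ?w\<close> and \<open>1\<close> are bounded by
    \<open>2 * ?m\<close> and \<open>?m\<close>, whence the \<open>3\<close> in
    \<open>twice_log2_add_3\<close>.\<close>
  also have "\<dots> \<le> 2 * log 2 A * ?m + 2 * ?m + ?m"
  proof -
    have "0 \<le> log 2 A"
      using A(1) by simp
    then have "2 * log 2 A * 1 \<le> 2 * log 2 A * ?m"
      by (intro mult_left_mono) auto
    then show ?thesis
      by linarith
  qed
  also have "\<dots> = (2 * log 2 A + 3) * ?m"
    by (simp add: algebra_simps)
  also have "\<dots> \<le> A * ?m"
    using twice_log2_add_3[OF A(1)] by (intro mult_right_mono) auto
  finally show ?case
    by simp
qed

lemma colour_log_star:
  assumes "\<And>i. x i \<noteq> x (i + j)" "\<And>i. real (x i) \<le> X"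
    and "16 \<le> A" "2 * log 2 X + 1 \<le> A * r"
  shows "real (colour j (Suc (log_star r)) x i) \<le> A"
proof -
  have "real (colour j (Suc (log_star r)) x i) \<le> A * max 1 ((log 2 ^^ log_star r) r)"
    by (rule colour_bound[where X = X]) (use assms in auto)
  then show ?thesis
    using iterated_log_log_star[of r] by (simp add: max_def split: if_splits)
qed


section \<open>Marking ancestors at bounded distances\<close>

text \<open>\<open>to_nat\<close> packs the tuple of colours into one number, so that colours are
  linearly ordered and have local maxima.\<close>

definition window_colour :: "nat \<Rightarrow> nat \<Rightarrow> (nat \<Rightarrow> nat) \<Rightarrow> nat \<Rightarrow> nat" where
  "window_colour K t x i = to_nat (map (\<lambda>j. colour j t x i) [1..<Suc K])"

lemma window_colour_neq:
  assumes "\<And>i j. 1 \<le> j \<Longrightarrow> j \<le> K \<Longrightarrow> x i \<noteq> x (i + j)" "1 \<le> j" "j \<le> K"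
  shows "window_colour K t x i \<noteq> window_colour K t x (i + j)"
proof -
  have "colour j t x i \<noteq> colour j t x (i + j)"
    using assms by (intro colour_neq) auto
  \<comment> \<open>\<open>j'\<close> renames the fixed distance \<open>j\<close>, which the bound
    variable of \<open>map\<close> would capture.\<close>
  then have "map (\<lambda>j. colour j t x i) [1..<Suc K] \<noteq> map (\<lambda>j. colour j t x (i + j')) [1..<Suc K]"
    if "j' = j" for j'
    using that assms(2,3) by (auto simp del: upt_Suc)
  then show ?thesis
    by (simp add: window_colour_def del: upt_Suc)
qed

text \<open>Only finitely many tuples of length \<open>K\<close> have entries up to
  \<open>A\<close>, so the largest code depends on \<open>K\<close> and \<open>A\<close> alone and
  not on the tree.\<close>

lemma window_colour_bound:
  "\<exists>Q. \<forall>t x i. (\<forall>j. 1 \<le> j \<longrightarrow> j \<le> K \<longrightarrow> colour j t x i \<le> A) \<longrightarrow> window_colour K t x i \<le> Q"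
proof -
  have fin: "finite (to_nat ` {xs. set xs \<subseteq> {..A} \<and> length xs = K})" (is "finite ?C")
    by (intro finite_imageI finite_lists_length_eq) simp
  have "window_colour K t x i \<in> ?C" if "\<forall>j. 1 \<le> j \<longrightarrow> j \<le> K \<longrightarrow> colour j t x i \<le> A" for t x i
    unfolding window_colour_def by (rule imageI) (use that in \<open>auto simp del: upt_Suc\<close>)
  then show ?thesis
    using Max_ge[OF fin] by blast
qed

text \<open>\<open>K \<le> i\<close> guarantees a full window on both sides; otherwise
  \<open>i - j\<close> would be truncated at \<open>0\<close>.\<close>

definition peak :: "nat \<Rightarrow> (nat \<Rightarrow> nat) \<Rightarrow> nat \<Rightarrow> bool" where
  "peak K c i \<longleftrightarrow> K \<le> i \<and> (\<forall>j. 1 \<le> j \<longrightarrow> j \<le> K \<longrightarrow> c (i + j) < c i \<and> c (i - j) < c i)"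

text \<open>Climbing from \<open>p\<close> to a larger colour at distance at most \<open>K\<close> stops after
  \<open>Q - c p\<close> steps.\<close>

lemma peak_near:
  assumes Q: "\<And>i. c i \<le> Q" and neq: "\<And>i j. 1 \<le> j \<Longrightarrow> j \<le> K \<Longrightarrow> c i \<noteq> c (i + j)"
    and "K + K * (Q - c p) \<le> p"
  shows "\<exists>q. peak K c q \<and> p \<le> q + K * (Q - c p) \<and> q \<le> p + K * (Q - c p)"
  using assms(3)
proof (induction "Q - c p" arbitrary: p rule: less_induct)
  case less
  show ?case
  proof (cases "peak K c p")
    case True
    then show ?thesis
      by auto
  next
    case False
    then obtain j where j: "1 \<le> j" "j \<le> K" "c p \<le> c (p + j) \<or> c p \<le> c (p - j)"
      using less.prems unfolding peak_def by (metis add_leD1 not_less)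
    have "c p \<noteq> c (p - j)"
      using neq[of j "p - j"] j less.prems by simp
    then obtain r where r: "c p < c r" "r = p + j \<or> r = p - j"
      using j neq[of j p] by (metis le_neq_implies_less)
    have drop: "Q - c r < Q - c p"
      using r(1) Q[of r] by linarith
    then have "K * Suc (Q - c r) \<le> K * (Q - c p)"
      by (intro mult_le_mono2) simp
    \<comment> \<open>A colour larger by at least one pays for the move of at most
      \<open>K\<close>.\<close>
    then have step: "K * (Q - c r) + K \<le> K * (Q - c p)"
      by simp
    have "K + K * (Q - c r) \<le> r"
      using step less.prems r(2) j by linarith
    from less.hyps[OF drop this] obtain q where q: "peak K c q"
      "r \<le> q + K * (Q - c r)" "q \<le> r + K * (Q - c r)"
      by blast
    have "p \<le> q + K * (Q - c p) \<and> q \<le> p + K * (Q - c p)"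
      using q(2,3) step r(2) j(2) by linarith
    then show ?thesis
      using q(1) by blast
  qed
qed

text \<open>Marks are only guaranteed from position \<open>K\<close> on: a path ends at the node where it is
  observed, so that \<open>peak\<close> lacks half of its window below \<open>K\<close>.\<close>

definition marking :: "nat \<Rightarrow> nat \<Rightarrow> (nat \<Rightarrow> bool) \<Rightarrow> bool" where
  "marking K D y \<longleftrightarrow> (\<forall>i \<ge> K. \<exists>p. y p \<and> i \<le> p \<and> p \<le> i + D) \<and>
     (\<forall>p q. y p \<longrightarrow> y q \<longrightarrow> p < q \<longrightarrow> K \<le> q - p)"

text \<open>Starting \<open>K * Q\<close> above \<open>i\<close> leaves room for a search that moves
  by at most \<open>K * Q\<close> either way. Two peaks too close would each have the larger
  colour.\<close>

lemma marking_peak: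
  assumes Q: "\<And>i. c i \<le> Q" and neq: "\<And>i j. 1 \<le> j \<Longrightarrow> j \<le> K \<Longrightarrow> c i \<noteq> c (i + j)"
  shows "marking K (2 * K * Q) (peak K c)"
  unfolding marking_def
proof (intro conjI allI impI)
  fix i assume i: "K \<le> i"
  let ?p = "i + K * Q"
  have le: "K * (Q - c ?p) \<le> K * Q"
    by simp
  then have "K + K * (Q - c ?p) \<le> ?p"
    using i by linarith
  then obtain q where "peak K c q" "?p \<le> q + K * (Q - c ?p)" "q \<le> ?p + K * (Q - c ?p)"
    using peak_near[OF Q neq] by blast
  then show "\<exists>p. peak K c p \<and> i \<le> p \<and> p \<le> i + 2 * K * Q"
    using le by (intro exI[of _ q]) (auto simp: algebra_simps)
next
  fix p q assume pq: "peak K c p" "peak K c q" "p < q"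
  show "K \<le> q - p"
  proof (rule ccontr)
    assume "\<not> K \<le> q - p"
    then have "c (p + (q - p)) < c p" "c (q - (q - p)) < c q"
      using pq unfolding peak_def by (metis less_imp_le not_less Suc_leI zero_less_diff One_nat_def)+
    then show False
      using pq(3) by simp
  qed
qed

lemma peak_cong:
  assumes "\<And>l. l \<le> i + K \<Longrightarrow> c l = c' l"
  shows "peak K c i = peak K c' i"
  using assms by (auto simp: peak_def)

text \<open>Below \<open>K\<close> this can fail: position \<open>K\<close> may be a peak for a
  child, while position \<open>K - 1\<close> never is one for its parent.\<close>

lemma peak_Suc:
  assumes "K \<le> i"
  shows "peak K c (Suc i) = peak K (\<lambda>i. c (Suc i)) i"
  using assms by (auto simp: peak_def Suc_diff_le)


section \<open>Labelling by the marks among the ancestors\<close>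

definition surrounding :: "(nat \<Rightarrow> bool) \<Rightarrow> nat \<Rightarrow> nat \<Rightarrow> nat \<Rightarrow> nat \<Rightarrow> bool" where
  "surrounding y W p0 p1 p2 \<longleftrightarrow> y p0 \<and> y p1 \<and> y p2 \<and> p0 < W \<and> W \<le> p1 \<and> p1 < p2 \<and>
     (\<forall>q. p0 < q \<longrightarrow> q < p2 \<longrightarrow> y q \<longrightarrow> q = p1)"

text \<open>A node is a cut node if its \<open>W\<close>-th ancestor is marked. For the marks \<open>p0\<close>, \<open>p1\<close>,
  \<open>p2\<close> surrounding \<open>W\<close>, the nearest cut nodes among a node and its ancestors are at distances
  \<open>p1 - W\<close> and \<open>p2 - W\<close>, and every path downwards from the nearer one meets the next cut node
  after exactly \<open>p1 - p0\<close> steps, because that mark lies above the node itself. The node therefore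
  belongs to a block of depth \<open>p1 - p0\<close> hanging below one of depth \<open>p2 - p1\<close>.\<close>

definition mark_label ::
  "(nat \<Rightarrow> 'l \<Rightarrow> nat list \<Rightarrow> 'l) \<Rightarrow> 'l \<Rightarrow> nat \<Rightarrow> (nat \<Rightarrow> bool) \<Rightarrow> (nat \<Rightarrow> nat) \<Rightarrow> 'l" where
  "mark_label F \<sigma>0 W y J =
     (let p0 = (GREATEST p. p < W \<and> y p); p1 = (LEAST p. W \<le> p \<and> y p);
          p2 = (LEAST p. p1 < p \<and> y p)
      in F (p1 - p0) (F (p2 - p1) \<sigma>0 (map J [p1 - W..<p2 - W])) (map J [0..<p1 - W]))"

lemma mark_label_surrounding:
  assumes "surrounding y W p0 p1 p2"
  shows "mark_label F \<sigma>0 W y J =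
    F (p1 - p0) (F (p2 - p1) \<sigma>0 (map J [p1 - W..<p2 - W])) (map J [0..<p1 - W])"
proof -
  note s = assms[unfolded surrounding_def]
  have 0: "(GREATEST p. p < W \<and> y p) = p0"
  proof (rule Greatest_equality)
    fix q assume "q < W \<and> y q"
    then show "q \<le> p0"
      using s by (metis less_le_trans less_trans not_le)
  qed (use s in simp)
  have 1: "(LEAST p. W \<le> p \<and> y p) = p1"
  proof (rule Least_equality)
    fix q assume "W \<le> q \<and> y q"
    then show "p1 \<le> q"
      using s by (metis less_le_trans less_trans not_le order_refl)
  qed (use s in simp)
  have 2: "(LEAST p. p1 < p \<and> y p) = p2"
  proof (rule Least_equality)
    fix q assume "p1 < q \<and> y q"
    then show "p2 \<le> q"
      using s by (metis less_le_trans less_trans not_le order_refl)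
  qed (use s in simp)
  show ?thesis
    unfolding mark_label_def 0 1 Let_def 2 ..
qed

text \<open>There is a mark between \<open>K\<close> and \<open>K + D\<close>, hence below
  \<open>W\<close>. So \<open>p0\<close> exists, and as the last mark below \<open>W\<close> it is
  at least \<open>K\<close>, where a node and its children agree on marks.\<close>

lemma marking_surrounding:
  assumes "marking K D y" "K + D < W"
  obtains p0 p1 p2 where "surrounding y W p0 p1 p2" "K \<le> p0" "p1 \<le> W + D" "p2 \<le> W + 2 * D + 1"
proof -
  have ex: "\<exists>p. y p \<and> i \<le> p \<and> p \<le> i + D" if "K \<le> i" for i
    using assms(1) that by (auto simp: marking_def)
  obtain r where r: "y r" "K \<le> r" "r \<le> K + D"
    using ex[of K] by auto
  define p0 where "p0 = (GREATEST p. p < W \<and> y p)"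
  have rW: "r < W \<and> y r"
    using r assms(2) by simp
  have bound: "\<forall>p. p < W \<and> y p \<longrightarrow> p \<le> W"
    by simp
  have p0: "p0 < W" "y p0" and p0_max: "\<And>p. p < W \<Longrightarrow> y p \<Longrightarrow> p \<le> p0"
    using GreatestI_nat[of "\<lambda>p. p < W \<and> y p" r W] Greatest_le_nat[of "\<lambda>p. p < W \<and> y p" _ W]
      rW bound unfolding p0_def by auto
  define p1 where "p1 = (LEAST p. W \<le> p \<and> y p)"
  obtain q1 where q1: "y q1" "W \<le> q1" "q1 \<le> W + D"
    using ex[of W] assms(2) by auto
  have p1: "W \<le> p1" "y p1" and p1_min: "\<And>p. W \<le> p \<Longrightarrow> y p \<Longrightarrow> p1 \<le> p"
    using LeastI[of "\<lambda>p. W \<le> p \<and> y p" q1] Least_le[of "\<lambda>p. W \<le> p \<and> y p"] q1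
    unfolding p1_def by auto
  define p2 where "p2 = (LEAST p. p1 < p \<and> y p)"
  obtain q2 where q2: "y q2" "Suc p1 \<le> q2" "q2 \<le> Suc p1 + D"
    using ex[of "Suc p1"] assms(2) p1(1) by auto
  have p2: "p1 < p2" "y p2" and p2_min: "\<And>p. p1 < p \<Longrightarrow> y p \<Longrightarrow> p2 \<le> p"
    using LeastI[of "\<lambda>p. p1 < p \<and> y p" q2] Least_le[of "\<lambda>p. p1 < p \<and> y p"] q2
    unfolding p2_def by auto
  have "surrounding y W p0 p1 p2"
    unfolding surrounding_def
    using p0 p1 p2 p0_max p1_min p2_min by (metis linorder_neqE_nat not_le)
  moreover have "K \<le> p0"
    using p0_max r rW by fastforce
  moreover have "p1 \<le> W + D"
    using p1_min q1 by fastforce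
  moreover from this have "p2 \<le> W + 2 * D + 1"
    using p2_min[of q2] q2 by simp
  ultimately show ?thesis
    using that by blast
qed

text \<open>No mark beyond \<open>p2\<close> matters, and \<open>J\<close> is read up to
  \<open>p2 - W - 1\<close>, which is at most \<open>2 * D\<close>.\<close>

lemma mark_label_cong:
  assumes "marking K D y" "K + D < W"
    and "\<And>i. i \<le> W + 2 * D + 1 \<Longrightarrow> y i = y' i" "\<And>i. i \<le> 2 * D \<Longrightarrow> J i = J' i"
  shows "mark_label F \<sigma>0 W y J = mark_label F \<sigma>0 W y' J'"
proof -
  obtain p0 p1 p2 where s: "surrounding y W p0 p1 p2" "p1 \<le> W + D" "p2 \<le> W + 2 * D + 1"
    using marking_surrounding[OF assms(1,2)] by blast
  have "surrounding y' W p0 p1 p2"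
    using s assms(3) unfolding surrounding_def by (auto simp: less_le_trans)
  moreover have "map J [p1 - W..<p2 - W] = map J' [p1 - W..<p2 - W]"
    "map J [0..<p1 - W] = map J' [0..<p1 - W]"
    using s(2,3) assms(4) by auto
  ultimately show ?thesis
    using mark_label_surrounding s(1) by metis
qed

section \<open>Correctness of the labelling by marks\<close>

locale uniform_blocks =
  fixes P :: "'l lcl" and S :: "'l set" and K :: nat and F :: "nat \<Rightarrow> 'l \<Rightarrow> nat list \<Rightarrow> 'l"
    and \<sigma>0 :: 'l
  assumes lcl: "lcl_problem P" and S: "S \<subseteq> labels P" "\<sigma>0 \<in> S" and K: "1 \<le> K"
    and blocks: "\<And>k. K \<le> k \<Longrightarrow> uniform_block P S k (F k)"
begin

lemma blocks_block: "K \<le> k \<Longrightarrow> block P S k (F k)"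
  using blocks unfolding uniform_block_def by blast

lemma blocks_root: "K \<le> k \<Longrightarrow> \<sigma> \<in> S \<Longrightarrow> F k \<sigma> [] = \<sigma>"
  using blocks_block unfolding block_def by blast

lemma blocks_leaf:
  "K \<le> k \<Longrightarrow> \<sigma> \<in> S \<Longrightarrow> set a \<subseteq> {..<arity P} \<Longrightarrow> length a = k \<Longrightarrow> F k \<sigma> a \<in> S"
  using blocks_block unfolding block_def by blast

lemma blocks_leaf_eq:
  "K \<le> k \<Longrightarrow> \<sigma> \<in> S \<Longrightarrow> \<tau> \<in> S \<Longrightarrow> set a \<subseteq> {..<arity P} \<Longrightarrow> length a = k \<Longrightarrow> F k \<sigma> a = F k \<tau> a"
  using blocks unfolding uniform_block_def by blast

lemma blocks_allowed:
  "K \<le> k \<Longrightarrow> \<sigma> \<in> S \<Longrightarrow> set a \<subseteq> {..<arity P} \<Longrightarrow> length a < k \<Longrightarrow>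
    allowed P (F k \<sigma> a) (map (\<lambda>i. F k \<sigma> (i # a)) [0..<arity P])"
  using blocks_block unfolding block_def by blast

lemma surrounding_gaps:
  assumes "marking K D y" "surrounding y W p0 p1 p2"
  shows "K \<le> p1 - p0" "K \<le> p2 - p1"
proof -
  have "K \<le> q - p" if "y p" "y q" "p < q" for p q
    using assms(1) that by (simp add: marking_def)
  then show "K \<le> p1 - p0" "K \<le> p2 - p1"
    using assms(2) by (auto simp: surrounding_def)
qed

lemma mark_label_in_labels:
  assumes y: "marking K D y" and W: "K + D < W" and J: "\<And>i. J i < arity P"
  shows "mark_label F \<sigma>0 W y J \<in> labels P"
proof -
  obtain p0 p1 p2 where s: "surrounding y W p0 p1 p2"
    using marking_surrounding[OF y W] by blast
  note gaps = surrounding_gaps[OF y s]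
  have "F (p2 - p1) \<sigma>0 (map J [p1 - W..<p2 - W]) \<in> S"
    using s J by (intro blocks_leaf[OF gaps(2) S(2)]) (auto simp: surrounding_def)
  then show ?thesis
    unfolding mark_label_surrounding[OF s]
    using s J by (intro block_labels[OF lcl S(1) blocks_block[OF gaps(1)]]) (auto simp: surrounding_def)
qed

text \<open>Seen from child \<open>c\<close>, the marks from \<open>K\<close> on move up by one. If
  \<open>p0\<close> stays below \<open>W\<close>, the child sits in the same block at address
  \<open>c # a\<close>. Otherwise it is itself a cut node: a leaf of this block and the root of the
  next one.\<close>

lemma mark_label_allowed:
  assumes y: "marking K D y" and W: "K + D < W" and J: "\<And>i. J i < arity P"
    and z: "\<And>c. c < arity P \<Longrightarrow> marking K D (z c)"
    and zy: "\<And>c i. c < arity P \<Longrightarrow> K \<le> i \<Longrightarrow> z c (Suc i) = y i"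
    and I: "\<And>c i. c < arity P \<Longrightarrow> I c (Suc i) = J i" "\<And>c. c < arity P \<Longrightarrow> I c 0 = c"
  shows "allowed P (mark_label F \<sigma>0 W y J)
    (map (\<lambda>c. mark_label F \<sigma>0 W (z c) (I c)) [0..<arity P])"
proof -
  obtain p0 p1 p2 where s: "surrounding y W p0 p1 p2" "K \<le> p0"
    using marking_surrounding[OF y W] by blast
  note gaps = surrounding_gaps[OF y s(1)]
  have ord: "p0 < W" "W \<le> p1" "p1 < p2"
    using s(1) by (auto simp: surrounding_def)
  define \<sigma> where "\<sigma> = F (p2 - p1) \<sigma>0 (map J [p1 - W..<p2 - W])"
  define a where "a = map J [0..<p1 - W]"
  have \<sigma>: "\<sigma> \<in> S"
    unfolding \<sigma>_def using ord J by (intro blocks_leaf[OF gaps(2) S(2)]) auto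
  have a: "set a \<subseteq> {..<arity P}" "length a = p1 - W"
    using J by (auto simp: a_def)
  have "mark_label F \<sigma>0 W (z c) (I c) = F (p1 - p0) \<sigma> (c # a)" if c: "c < arity P" for c
  proof -
    have map_I: "map (I c) [Suc m..<Suc n] = map J [m..<n]" for m n
      using I(1)[OF c] by (simp add: map_Suc_upt[symmetric] del: upt_Suc)
    have map_I0: "map (I c) [0..<Suc n] = c # map J [0..<n]" for n
      using I(1,2)[OF c] by (simp add: map_upt_Suc del: upt_Suc)
    have zpos: "z c q \<longleftrightarrow> y (q - 1)" if "K < q" for q
      using zy[OF c, of "q - 1"] that by (cases q) auto
    show ?thesis
    proof (cases "Suc p0 < W")
      case True
      have "surrounding (z c) W (Suc p0) (Suc p1) (Suc p2)"
        unfolding surrounding_def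
      proof (intro conjI allI impI)
        fix q assume q: "Suc p0 < q" "q < Suc p2" "z c q"
        then have "y (q - 1)" "p0 < q - 1" "q - 1 < p2"
          using zpos s(2) by auto
        then have "q - 1 = p1"
          using s(1) by (simp add: surrounding_def)
        then show "q = Suc p1"
          using q(1) by simp
      qed (use s True ord zpos in \<open>auto simp: surrounding_def\<close>)
      then show ?thesis
        using ord mark_label_surrounding[of "z c" W "Suc p0" "Suc p1" "Suc p2" F \<sigma>0 "I c"]
        by (simp add: Suc_diff_le map_I map_I0 \<sigma>_def a_def del: upt_Suc)
    next
      case False
      then have W0: "W = Suc p0"
        using ord by simp
      obtain r0 r1 r2 where r: "surrounding (z c) W r0 r1 r2"
        using marking_surrounding[OF z[OF c] W] by blast
      have zW: "z c W"
        using s W0 by (simp add: zpos surrounding_def)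
      have z1: "z c (Suc p1)"
        using s ord by (simp add: zpos surrounding_def)
      have none: "\<not> z c q" if "W < q" "q < Suc p1" for q
      proof
        assume "z c q"
        then have "y (q - 1)"
          using zpos that s(2) W0 by simp
        moreover have "p0 < q - 1" "q - 1 < p2" "q - 1 \<noteq> p1"
          using that W0 ord by auto
        ultimately show False
          using s(1) by (auto simp: surrounding_def)
      qed
      have r1: "r1 = W"
        using r zW unfolding surrounding_def by (metis le_neq_implies_less less_le_trans order_refl less_trans)
      have r2: "r2 = Suc p1"
      proof (rule antisym)
        show "r2 \<le> Suc p1"
          using r z1 ord r1 unfolding surrounding_def
          by (metis le_imp_less_Suc less_le_trans less_not_refl not_le order_less_imp_le)
        show "Suc p1 \<le> r2"
          using none r r1 unfolding surrounding_def by (metis not_le)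
      qed
      have k: "Suc p1 - W = p1 - p0"
        using W0 by simp
      have ca: "set (c # a) \<subseteq> {..<arity P}" "length (c # a) = p1 - p0"
        using a c ord W0 by auto
      \<comment> \<open>For the child, the block above it is the one containing its parent, read
        with root label \<open>\<sigma>0\<close> in place of \<open>\<sigma>\<close>; uniformity
        makes the leaf labels equal.\<close>
      have "F (r2 - r1) \<sigma>0 (map (I c) [r1 - W..<r2 - W]) = F (p1 - p0) \<sigma>0 (c # a)"
        using ord by (simp add: r1 r2 k[symmetric] Suc_diff_le map_I0 a_def del: upt_Suc)
      moreover have "F (p1 - p0) \<sigma>0 (c # a) \<in> S" "F (p1 - p0) \<sigma>0 (c # a) = F (p1 - p0) \<sigma> (c # a)"
        using blocks_leaf[OF gaps(1) S(2) ca] blocks_leaf_eq[OF gaps(1) S(2) \<sigma> ca] by auto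
      \<comment> \<open>The block below the child may have any depth from \<open>K\<close> on, since
        its root always carries the prescribed label.\<close>
      moreover have "K \<le> r1 - r0"
        using surrounding_gaps[OF z[OF c] r] by simp
      ultimately show ?thesis
        using mark_label_surrounding[OF r, of F \<sigma>0 "I c"] blocks_root[of "r1 - r0"] r1 by simp
    qed
  qed
  then have children: "map (\<lambda>c. mark_label F \<sigma>0 W (z c) (I c)) [0..<arity P]
      = map (\<lambda>c. F (p1 - p0) \<sigma> (c # a)) [0..<arity P]"
    by simp
  have node: "mark_label F \<sigma>0 W y J = F (p1 - p0) \<sigma> a"
    by (simp add: mark_label_surrounding[OF s(1)] \<sigma>_def a_def)
  have "length a < p1 - p0"
    using a ord by simp
  then show ?thesis
    unfolding children node by (rule blocks_allowed[OF gaps(1) \<sigma> a(1)])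
qed

end


section \<open>Messages\<close>

fun binary :: "nat \<Rightarrow> bool list" where
  "binary n = (if n = 0 then [] else odd n # binary (n div 2))"

declare binary.simps [simp del]

lemma binary_inject: "binary m = binary n \<longleftrightarrow> m = n"
proof
  show "binary m = binary n \<Longrightarrow> m = n"
  proof (induction m arbitrary: n rule: binary.induct)
    case (1 m)
    show ?case
    proof (cases "m = 0 \<or> n = 0")
      case True
      then show ?thesis
        using "1.prems" by (auto simp: binary.simps[of m] binary.simps[of n] split: if_splits)
    next
      case False
      then have "odd m = odd n" "binary (m div 2) = binary (n div 2)"
        using "1.prems" by (auto simp: binary.simps[of m] binary.simps[of n])
      then have "m mod 2 = n mod 2" "m div 2 = n div 2"
        using "1.IH" False by (auto simp: mod_2_eq_odd)
      then show ?thesis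
        by (metis div_mult_mod_eq)
    qed
  qed
qed simp

lemma power_length_binary: "0 < n \<Longrightarrow> 2 ^ length (binary n) \<le> 2 * n"
proof (induction n rule: binary.induct)
  case (1 n)
  show ?case
  proof (cases "n div 2 = 0")
    case True
    then show ?thesis
      using "1.prems" by (simp add: binary.simps)
  next
    case False
    then have "2 ^ length (binary (n div 2)) \<le> 2 * (n div 2)"
      using "1.IH" "1.prems" by simp
    then show ?thesis
      using "1.prems" by (simp add: binary.simps[of n])
  qed
qed

lemma length_binary:
  assumes "real n \<le> X" "1 \<le> X"
  shows "real (length (binary n)) \<le> log 2 X + 1"
proof (cases "n = 0")
  case True
  then show ?thesis
    using assms by (simp add: binary.simps)
next
  case False
  have "real (2 ^ length (binary n)) \<le> real (2 * n)"
    using power_length_binary[of n] False by (intro of_nat_mono) simp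
  also have "\<dots> \<le> 2 * X"
    using assms by simp
  finally have "2 powr real (length (binary n)) \<le> 2 * X"
    by (simp add: powr_realpow)
  then have "real (length (binary n)) \<le> log 2 (2 * X)"
    using assms by (simp add: le_log_iff)
  then show ?thesis
    using assms by (simp add: log_mult)
qed

text \<open>Unary is affordable for the child index \<open>b\<close>, which is bounded by the arity;
  its end is the first \<open>True\<close>, and the identifier \<open>a\<close> follows in
  binary.\<close>

definition encode :: "nat \<times> nat \<Rightarrow> message" where
  "encode = (\<lambda>(a, b). replicate b False @ True # binary a)"

definition decode :: "message \<Rightarrow> nat \<times> nat" where
  "decode = inv encode"

lemma decode_encode [simp]: "decode (encode x) = x"
proof -
  have "b = b' \<and> xs = ys"
    if "replicate b False @ True # xs = replicate b' False @ True # ys" for b b' xs ys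
    using that
  proof (induction b arbitrary: b')
    case 0
    then show ?case
      by (cases b') auto
  next
    case (Suc b)
    then show ?case
      by (cases b') auto
  qed
  then have "encode (a, b) = encode (a', b') \<Longrightarrow> (a, b) = (a', b')" for a b a' b'
    unfolding encode_def by (metis (no_types, lifting) binary_inject list.inject prod.case)
  then have "inj encode"
    by (metis injI surj_pair)
  then show ?thesis
    by (simp add: decode_def)
qed

lemma length_encode:
  assumes "real a \<le> X" "1 \<le> X" "b \<le> m"
  shows "real (length (encode (a, b))) \<le> real m + 2 + log 2 X"
  using length_binary[OF assms(1,2)] assms(3) by (simp add: encode_def)


section \<open>Collecting the ancestors\<close>

text \<open>Skips the port \<open>q\<close> of the parent, so that the \<open>\<delta>\<close> children get the indices below \<open>\<delta>\<close>.\<close>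

definition child_index :: "nat option \<Rightarrow> nat \<Rightarrow> nat" where
  "child_index q i = (case q of None \<Rightarrow> i | Some q \<Rightarrow> if i < q then i else i - 1)"

text \<open>The index depends on the port numbering of the parent, so a node has to learn its own
  index from the parent.\<close>

definition index_in_parent :: "'v network \<Rightarrow> 'v \<Rightarrow> nat" where
  "index_in_parent N v = (if v = tree_root N then 0
     else child_index (parent_port (initial_knowledge N (parent N v))) (port_to N (parent N v) v))"

text \<open>Identifier and index in the parent of the \<open>i\<close>-th ancestor. The path to the root is
  continued by virtual ancestors with the identifiers \<open>w 0, w 1, \<dots>\<close>, which spares the case
  distinction between nodes close to the root and all others.\<close>

fun ancestor :: "(nat \<Rightarrow> nat) \<Rightarrow> 'v network \<Rightarrow> nat \<Rightarrow> 'v \<Rightarrow> nat \<times> nat" where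
  "ancestor w N 0 v = (ident N v, index_in_parent N v)"
| "ancestor w N (Suc i) v = (if v = tree_root N then (w i, 0) else ancestor w N i (parent N v))"

lemma ancestor_child:
  assumes "u \<in> children N v"
  shows "ancestor w N (Suc i) u = ancestor w N i v"
  using assms by (simp add: children_def)

text \<open>What a node with parent port \<open>q\<close> learns from the message received in round \<open>r\<close>: the
  identifier of its ancestor number \<open>r + 1\<close> and the index of its ancestor number \<open>r\<close>.\<close>

definition learned :: "(nat \<Rightarrow> nat) \<Rightarrow> nat option \<Rightarrow> message list list \<Rightarrow> nat \<Rightarrow> nat \<times> nat" where
  "learned w q h r = (case q of None \<Rightarrow> (w r, 0) | Some q \<Rightarrow> decode (h ! r ! q))"

text \<open>A message carries the identifier of one ancestor and the index of the ancestor just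
  below it, so the two components at \<open>i\<close> stem from different rounds.\<close>

definition gathered :: "(nat \<Rightarrow> nat) \<Rightarrow> local_state \<Rightarrow> nat \<Rightarrow> nat \<times> nat" where
  "gathered w s i =
     ((case i of 0 \<Rightarrow> own_id (fst s) | Suc r \<Rightarrow> fst (learned w (parent_port (fst s)) (snd s) r)),
      snd (learned w (parent_port (fst s)) (snd s) i))"

text \<open>A node first sends its own identifier and the index of the receiving child, later what
  it learned in the round before. An empty history \<open>h\<close> marks the first round.\<close>

definition collecting ::
  "(nat \<Rightarrow> nat \<Rightarrow> nat) \<Rightarrow> (nat \<Rightarrow> nat) \<Rightarrow> (nat \<Rightarrow> (nat \<Rightarrow> nat \<times> nat) \<Rightarrow> 'l) \<Rightarrow> 'l algorithm" where
  "collecting w R g =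
     \<lparr> send = (\<lambda>(k, h) i. encode
         (if h = [] then (own_id k, child_index (parent_port k) i)
          else learned (w (num_nodes k)) (parent_port k) h (length h - 1))),
       out = (\<lambda>(k, h). if length h < R (num_nodes k) then None
         else Some (g (num_nodes k) (gathered (w (num_nodes k)) (k, h)))) \<rparr>"

lemma length_received [simp]: "length (received A N t v) = t"
  by (induction t) simp_all

lemma port_to:
  assumes "valid_network p N" "v \<in> nodes N" "u \<in> neighbors N v"
  shows "port_to N v u < node_degree N v" "port N v (port_to N v u) = u"
proof -
  have "bij_betw (port N v) {..<node_degree N v} (neighbors N v)"
    using assms(1,2) by (simp add: valid_network_def)
  then have u: "u \<in> port N v ` {..<node_degree N v}"
    using assms(3) by (simp add: bij_betw_def)
  show "port_to N v u < node_degree N v" "port N v (port_to N v u) = u"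
    using inv_into_into[OF u] f_inv_into_f[OF u] by (simp_all add: port_to_def)
qed

text \<open>Induction on the number of rounds: after the first round the parent \<open>u\<close>
  forwards what it learned one round before, and ancestor \<open>i\<close> of \<open>u\<close> is
  ancestor \<open>i + 1\<close> of \<open>v\<close>.\<close>

lemma learned_collecting:
  fixes w :: "nat \<Rightarrow> nat \<Rightarrow> nat" and R :: "nat \<Rightarrow> nat"
    and g :: "nat \<Rightarrow> (nat \<Rightarrow> nat \<times> nat) \<Rightarrow> 'l"
  assumes N: "valid_network p N" and "v \<in> nodes N" "r < t"
  defines "A \<equiv> collecting w R g" and "wn \<equiv> w (card (nodes N))"
  shows "learned wn (parent_port (initial_knowledge N v)) (received A N t v) r
    = (fst (ancestor wn N (Suc r) v), snd (ancestor wn N r v))"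
  using assms(2,3)
proof (induction t arbitrary: v r)
  case (Suc t)
  have rt: "rooted_tree N"
    using N by (simp add: valid_network_def)
  show ?case
  proof (cases "v = tree_root N")
    case True
    then show ?thesis
      by (cases r) (simp_all add: learned_def initial_knowledge_def index_in_parent_def)
  next
    case False
    define u where "u = parent N v"
    have u: "u \<in> nodes N" "v \<in> children N u"
      using parent_in_nodes[OF rt Suc.prems(1) False] Suc.prems(1) False
      by (auto simp: u_def children_def)
    have q: "port_to N v u < node_degree N v" "port N v (port_to N v u) = u"
      using port_to[OF N Suc.prems(1), of u] False by (auto simp: neighbors_def u_def)
    have pp: "parent_port (initial_knowledge N v) = Some (port_to N v u)"
      using False by (simp add: initial_knowledge_def u_def)
    show ?thesis
    proof (cases "r < t")
      case True
      then show ?thesis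
        using Suc.IH[OF Suc.prems(1) True] by (simp add: learned_def pp nth_append)
    next
      case False
      then have r: "r = t"
        using Suc.prems by simp
      have "learned wn (parent_port (initial_knowledge N v)) (received A N (Suc t) v) r
          = decode (send A (initial_knowledge N u, received A N t u) (port_to N u v))"
        using q by (simp add: learned_def pp nth_append r Let_def)
      also have "\<dots> = (fst (ancestor wn N t u), snd (ancestor wn N t v))"
      proof (cases t)
        case 0
        then show ?thesis
          using \<open>v \<noteq> tree_root N\<close>
          by (simp add: A_def collecting_def initial_knowledge_def index_in_parent_def u_def)
      next
        case (Suc s)
        have "received A N t u \<noteq> []"
          using Suc by (metis length_received list.size(3) nat.distinct(1))
        then have "decode (send A (initial_knowledge N u, received A N t u) (port_to N u v))
            = learned wn (parent_port (initial_knowledge N u)) (received A N t u) s"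
          unfolding A_def wn_def using Suc
          by (simp add: collecting_def initial_knowledge_def del: received.simps)
        also have "\<dots> = (fst (ancestor wn N (Suc s) u), snd (ancestor wn N s u))"
          using Suc by (intro Suc.IH u(1)) simp
        also have "\<dots> = (fst (ancestor wn N t u), snd (ancestor wn N t v))"
          unfolding Suc ancestor_child[OF u(2)] ..
        finally show ?thesis .
      qed
      also have "\<dots> = (fst (ancestor wn N (Suc r) v), snd (ancestor wn N r v))"
        unfolding r ancestor_child[OF u(2)] ..
      finally show ?thesis .
    qed
  qed
qed simp

lemma gathered_collecting:
  fixes w :: "nat \<Rightarrow> nat \<Rightarrow> nat" and R :: "nat \<Rightarrow> nat"
    and g :: "nat \<Rightarrow> (nat \<Rightarrow> nat \<times> nat) \<Rightarrow> 'l"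
  assumes N: "valid_network p N" and v: "v \<in> nodes N" "i < t"
  defines "wn \<equiv> w (card (nodes N))"
  shows "gathered wn (state_after (collecting w R g) N t v) i = ancestor wn N i v"
proof -
  let ?l = "learned wn (parent_port (initial_knowledge N v)) (received (collecting w R g) N t v)"
  have l: "?l r = (fst (ancestor wn N (Suc r) v), snd (ancestor wn N r v))" if "r < t" for r
    unfolding wn_def by (rule learned_collecting[OF N v(1) that])
  have "(case i of 0 \<Rightarrow> own_id (initial_knowledge N v) | Suc r \<Rightarrow> fst (?l r)) = fst (ancestor wn N i v)"
  proof (cases i)
    case 0
    then show ?thesis
      by (simp add: initial_knowledge_def)
  next
    case (Suc r)
    then show ?thesis
      using l[of r] v(2) by simp
  qed
  moreover have "snd (?l i) = snd (ancestor wn N i v)"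
    using l[OF v(2)] by simp
  ultimately show ?thesis
    unfolding gathered_def state_after_def fst_conv snd_conv by (simp add: prod_eq_iff)
qed

lemma collecting_out:
  "out (collecting w R g) (state_after (collecting w R g) N t v) = (if t < R (card (nodes N)) then None
     else Some (g (card (nodes N)) (gathered (w (card (nodes N))) (state_after (collecting w R g) N t v))))"
  unfolding collecting_def by (simp add: state_after_def initial_knowledge_def)

lemma collecting_terminates: "terminates_within (collecting w R g) N (R (card (nodes N)))"
  by (auto simp: terminates_within_def collecting_out)

lemma collecting_output_label:
  "output_label (collecting w R g) N v = g (card (nodes N))
    (gathered (w (card (nodes N))) (state_after (collecting w R g) N (R (card (nodes N))) v))"
proof -
  have "(LEAST t. out (collecting w R g) (state_after (collecting w R g) N t v) \<noteq> None)
      = R (card (nodes N))"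
    by (rule Least_equality) (auto simp: collecting_out split: if_splits)
  then show ?thesis
    by (simp add: output_label_def collecting_out)
qed


subsection \<open>Indices of the children\<close>

lemma parent_notin_children:
  assumes "rooted_tree N" "v \<in> nodes N" "v \<noteq> tree_root N"
  shows "parent N v \<notin> children N v"
proof
  assume "parent N v \<in> children N v"
  then show False
    using node_depth_child[OF assms(1)] node_depth_parent[OF assms] by fastforce
qed

lemma node_degree_eq:
  assumes "rooted_tree N" "v \<in> nodes N"
  shows "node_degree N v = card (children N v) + (if v = tree_root N then 0 else 1)"
  using finite_children[OF assms(1), of v] parent_notin_children[OF assms]
  by (simp add: node_degree_def neighbors_def)

text \<open>\<open>child_index\<close> is injective away from the parent port, and that port leads
  to no child.\<close>

lemma child_index_children:
  assumes N: "valid_network p N" and v: "v \<in> nodes N"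
  shows "inj_on (index_in_parent N) (children N v)"
    and "u \<in> children N v \<Longrightarrow> index_in_parent N u < card (children N v)"
proof -
  have rt: "rooted_tree N"
    using N by (simp add: valid_network_def)
  let ?q = "parent_port (initial_knowledge N v)"
  have idx: "index_in_parent N u = child_index ?q (port_to N v u)" if "u \<in> children N v" for u
    using that by (simp add: index_in_parent_def children_def)
  have port: "port_to N v u < node_degree N v" "port N v (port_to N v u) = u"
    if "u \<in> children N v" for u
    using port_to[OF N v] that by (auto simp: neighbors_def)
  have q: "port_to N v u \<noteq> i \<and> i < node_degree N v"
    if i: "?q = Some i" and u: "u \<in> children N v" for u i
  proof -
    have v': "v \<noteq> tree_root N" "i = port_to N v (parent N v)"
      using i by (auto simp: initial_knowledge_def split: if_splits)
    then have "i < node_degree N v" "port N v i = parent N v"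
      using port_to[OF N v, of "parent N v"] by (simp_all add: neighbors_def)
    moreover have "parent N v \<noteq> u"
      using parent_notin_children[OF rt v v'(1)] u by blast
    ultimately show ?thesis
      using port(2)[OF u] by auto
  qed
  show "inj_on (index_in_parent N) (children N v)"
  proof (rule inj_onI)
    fix u u' assume u: "u \<in> children N v" "u' \<in> children N v"
      and "index_in_parent N u = index_in_parent N u'"
    then have "child_index ?q (port_to N v u) = child_index ?q (port_to N v u')"
      by (simp add: idx)
    then have "port_to N v u = port_to N v u'"
      using q[OF _ u(1)] q[OF _ u(2)]
      by (fastforce simp: child_index_def split: option.splits if_splits)
    then show "u = u'"
      using port[OF u(1)] port[OF u(2)] by metis
  qed
  show "index_in_parent N u < card (children N v)" if u: "u \<in> children N v"
  proof (cases ?q)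
    case None
    then have "v = tree_root N"
      by (simp add: initial_knowledge_def split: if_splits)
    then show ?thesis
      using port[OF u] None node_degree_eq[OF rt v] by (simp add: idx[OF u] child_index_def)
  next
    case (Some i)
    then have "v \<noteq> tree_root N"
      by (auto simp: initial_knowledge_def)
    then show ?thesis
      using port(1)[OF u] q[OF Some u] node_degree_eq[OF rt v]
      by (auto simp: idx[OF u] child_index_def Some)
  qed
qed

lemma children_by_index:
  assumes N: "valid_network p N" and v: "v \<in> nodes N"
  obtains h where "inj_on h {..<card (children N v)}" "h ` {..<card (children N v)} = children N v"
    "\<And>c. c < card (children N v) \<Longrightarrow> index_in_parent N (h c) = c"
proof -
  note idx = child_index_children[OF N v]
  have "index_in_parent N ` children N v = {..<card (children N v)}"
    using idx by (intro card_subset_eq) (auto simp: card_image)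
  then have bij: "bij_betw (index_in_parent N) (children N v) {..<card (children N v)}"
    using idx(1) by (simp add: bij_betw_def)
  let ?h = "inv_into (children N v) (index_in_parent N)"
  have "bij_betw ?h {..<card (children N v)} (children N v)"
    using bij by (rule bij_betw_inv_into)
  then have "inj_on ?h {..<card (children N v)}" "?h ` {..<card (children N v)} = children N v"
    by (auto simp: bij_betw_def)
  then show ?thesis
    using that bij_betw_inv_into_right[OF bij] by blast
qed

lemma ancestor_index:
  assumes N: "valid_network p N" "full_tree \<delta> N" "1 \<le> \<delta>" and v: "v \<in> nodes N"
  shows "snd (ancestor w N i v) < \<delta>"
  using v
proof (induction i arbitrary: v)
  case 0
  have rt: "rooted_tree N"
    using N(2) by (simp add: full_tree_def)
  show ?case
  proof (cases "v = tree_root N")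
    case True
    then show ?thesis
      using N(3) by (simp add: index_in_parent_def)
  next
    case False
    let ?u = "parent N v"
    have "?u \<in> nodes N" "v \<in> children N ?u"
      using parent_in_nodes[OF rt 0 False] 0 False by (auto simp: children_def)
    then have "index_in_parent N v < card (children N ?u)" "card (children N ?u) \<le> \<delta>"
      using child_index_children(2)[OF N(1)] N(2) by (auto simp: full_tree_def)
    then show ?thesis
      by simp
  qed
next
  case (Suc i)
  then show ?case
    using N by (auto simp: full_tree_def intro: parent_in_nodes)
qed


subsection \<open>Identifiers of the ancestors\<close>

text \<open>Values above \<open>b\<close> avoid all real identifiers, and period
  \<open>K + 1\<close> separates distances up to \<open>K\<close> while keeping the values
  bounded.\<close>

definition virtual_id :: "nat \<Rightarrow> nat \<Rightarrow> nat \<Rightarrow> nat" where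
  "virtual_id K b i = Suc b + i mod Suc K"

lemma virtual_id_neq:
  assumes "1 \<le> j" "j \<le> K"
  shows "virtual_id K b i \<noteq> virtual_id K b (i + j)"
proof
  assume "virtual_id K b i = virtual_id K b (i + j)"
  then have "(i + j) mod Suc K = i mod Suc K"
    by (simp add: virtual_id_def)
  then have "Suc K dvd i + j - i"
    by (metis le_add1 mod_eq_dvd_iff_nat)
  then show False
    using assms by (auto dest: dvd_imp_le)
qed

text \<open>The depth equation shows that ancestors at positive distance are different
  nodes.\<close>

lemma ancestor_cases:
  assumes N: "valid_network p N" and v: "v \<in> nodes N"
  shows "(\<exists>i'. fst (ancestor w N i v) = w i') \<or>
    (\<exists>u \<in> nodes N. node_depth N u + i = node_depth N v \<and> fst (ancestor w N i v) = ident N u)"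
  using v
proof (induction i arbitrary: v)
  case (Suc i)
  have rt: "rooted_tree N"
    using N by (simp add: valid_network_def)
  show ?case
  proof (cases "v = tree_root N")
    case False
    then show ?thesis
      using Suc.IH[OF parent_in_nodes[OF rt Suc.prems False]] node_depth_parent[OF rt Suc.prems False]
      by simp
  qed auto
qed auto

lemma ident_le:
  assumes "valid_network p N" "v \<in> nodes N"
  shows "ident N v \<le> poly p (card (nodes N))"
  using assms by (auto simp: valid_network_def)

lemma ancestor_id_le:
  assumes N: "valid_network p N" and v: "v \<in> nodes N" and b: "b = poly p (card (nodes N))"
  shows "fst (ancestor (virtual_id K b) N i v) \<le> b + K + 1"
proof -
  have "virtual_id K b i' \<le> b + K + 1" for i'
    using mod_less_divisor[of "Suc K" i'] by (simp add: virtual_id_def)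
  then show ?thesis
    using ancestor_cases[OF N v, of "virtual_id K b" i] ident_le[OF N]
    by (metis b le_add1 le_trans add.assoc)
qed

lemma ancestor_id_neq:
  assumes N: "valid_network p N" and v: "v \<in> nodes N" and b: "b = poly p (card (nodes N))"
    and j: "1 \<le> j" "j \<le> K"
  shows "fst (ancestor (virtual_id K b) N i v) \<noteq> fst (ancestor (virtual_id K b) N (i + j) v)"
  using v
proof (induction i arbitrary: v)
  case 0
  have le: "ident N v \<le> b"
    using ident_le[OF N 0] b by simp
  consider i' where "fst (ancestor (virtual_id K b) N j v) = virtual_id K b i'"
    | u where "u \<in> nodes N" "node_depth N u + j = node_depth N v"
      "fst (ancestor (virtual_id K b) N j v) = ident N u"
    using ancestor_cases[OF N 0] by blast
  then show ?case
  proof cases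
    case 1
    moreover have "b < virtual_id K b i'"
      by (simp add: virtual_id_def)
    ultimately show ?thesis
      using le by simp
  next
    case 2
    have "u \<noteq> v"
      using 2(2) j by auto
    then show ?thesis
      using 2 0 N by (auto simp: valid_network_def inj_on_def)
  qed
next
  case (Suc i)
  have rt: "rooted_tree N"
    using N by (simp add: valid_network_def)
  show ?case
  proof (cases "v = tree_root N")
    case True
    then show ?thesis
      using virtual_id_neq[OF j] by simp
  next
    case False
    then show ?thesis
      using Suc.IH parent_in_nodes[OF rt Suc.prems False] by simp
  qed
qed

lemma collecting_message_size:
  assumes N: "valid_network p N" "full_tree \<delta> N" "1 \<le> \<delta>"
    and w: "w (card (nodes N)) = virtual_id K (poly p (card (nodes N)))"
    and X: "real (poly p (card (nodes N)) + K + 1) \<le> X" "1 \<le> X"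
    and b: "real \<delta> + 2 + log 2 X \<le> real b"
  shows "message_size_bounded (collecting w R g) N b"
  unfolding message_size_bounded_def
proof (intro allI ballI impI)
  fix t v i assume v: "v \<in> nodes N" and i: "i < node_degree N v"
  let ?A = "collecting w R g"
  have rt: "rooted_tree N"
    using N(1) by (simp add: valid_network_def)
  obtain x y where xy: "send ?A (state_after ?A N t v) i = encode (x, y)"
    "x \<le> poly p (card (nodes N)) + K + 1" "y \<le> \<delta>"
  proof (cases t)
    case 0
    have "child_index (parent_port (initial_knowledge N v)) i \<le> i"
      by (simp add: child_index_def split: option.splits)
    \<comment> \<open>The edge to the parent adds one to the degree, so port numbers are at most
      \<open>\<delta>\<close>.\<close>
    moreover have "node_degree N v \<le> Suc \<delta>"
      using N(2) v node_degree_eq[OF rt v] by (auto simp: full_tree_def)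
    ultimately show thesis
      using that[of "ident N v" "child_index (parent_port (initial_knowledge N v)) i"] 0 i
        ident_le[OF N(1) v]
      by (simp add: collecting_def state_after_def initial_knowledge_def)
  next
    case (Suc s)
    have "received ?A N t v \<noteq> []"
      using Suc by (metis length_received list.size(3) nat.distinct(1))
    then have "send ?A (state_after ?A N t v) i
        = encode (learned (w (card (nodes N))) (parent_port (initial_knowledge N v)) (received ?A N t v) s)"
      using Suc by (simp add: collecting_def state_after_def initial_knowledge_def del: received.simps)
    also have "\<dots> = encode (fst (ancestor (w (card (nodes N))) N (Suc s) v),
        snd (ancestor (w (card (nodes N))) N s v))"
      using learned_collecting[OF N(1) v, of s t w R g] Suc by simp
    finally show thesis
      using that ancestor_id_le[OF N(1) v refl] ancestor_index[OF N v] w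
      by (metis less_imp_le)
  qed
  have "real x \<le> X"
    using xy(2) X(1) by linarith
  then have "real (length (encode (x, y))) \<le> real \<delta> + 2 + log 2 X"
    using X(2) xy(3) by (rule length_encode)
  then show "length (send ?A (state_after ?A N t v) i) \<le> b"
    using b unfolding xy(1) by linarith
qed


section \<open>The algorithm\<close>

definition ancestor_label ::
  "(nat \<Rightarrow> 'l \<Rightarrow> nat list \<Rightarrow> 'l) \<Rightarrow> 'l \<Rightarrow> nat \<Rightarrow> nat \<Rightarrow> nat \<Rightarrow> (nat \<Rightarrow> nat \<times> nat) \<Rightarrow> 'l" where
  "ancestor_label F \<sigma>0 K W t s =
     mark_label F \<sigma>0 W (peak K (window_colour K t (\<lambda>i. fst (s i)))) (\<lambda>i. snd (s i))"

lemma window_colour_cong: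
  assumes "\<And>l. l \<le> i + K * t \<Longrightarrow> x l = x' l"
  shows "window_colour K t x i = window_colour K t x' i"
proof -
  have "colour j t x i = colour j t x' i" if "j \<le> K" for j
  proof (rule colour_cong)
    fix l assume "l \<le> i + j * t"
    then have "l \<le> i + K * t"
      using mult_le_mono1[OF that, of t] by linarith
    then show "x l = x' l"
      by (rule assms)
  qed
  then have "map (\<lambda>j. colour j t x i) [1..<Suc K] = map (\<lambda>j. colour j t x' i) [1..<Suc K]"
    by (simp del: upt_Suc)
  then show ?thesis
    by (simp add: window_colour_def)
qed

text \<open>The radii add up: \<open>W + 2 * D + 1\<close> for the marks, \<open>K\<close> for
  recognising a peak and \<open>K * t\<close> for the colours. The sum dictates the number of
  rounds.\<close>

lemma ancestor_label_cong:
  assumes "marking K D (peak K (window_colour K t (\<lambda>i. fst (s i))))" "K + D < W"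
    and s: "\<And>i. i < W + 2 * D + 2 + K + K * t \<Longrightarrow> s i = s' i"
  shows "ancestor_label F \<sigma>0 K W t s = ancestor_label F \<sigma>0 K W t s'"
  unfolding ancestor_label_def
proof (rule mark_label_cong[OF assms(1,2)])
  fix i assume i: "i \<le> W + 2 * D + 1"
  show "peak K (window_colour K t (\<lambda>i. fst (s i))) i = peak K (window_colour K t (\<lambda>i. fst (s' i))) i"
  proof (intro peak_cong window_colour_cong)
    fix l l' assume "l \<le> i + K" "l' \<le> l + K * t"
    then have "l' < W + 2 * D + 2 + K + K * t"
      using i by linarith
    then show "fst (s l') = fst (s' l')"
      using s by simp
  qed
qed (use s in auto)

lemma window_colour_Suc:
  assumes "\<And>i. x (Suc i) = x' i"
  shows "window_colour K t x (Suc i) = window_colour K t x' i"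
  by (simp add: window_colour_def colour_Suc_index assms)

lemma peak_window_colour_Suc:
  assumes "\<And>i. x (Suc i) = x' i" "K \<le> i"
  shows "peak K (window_colour K t x) (Suc i) = peak K (window_colour K t x') i"
  by (simp add: peak_Suc[OF assms(2)] window_colour_Suc[of x x', OF assms(1)])

context uniform_blocks
begin

lemma correct_ancestor_labeling:
  assumes N: "valid_network p N" "full_tree (arity P) N" and W: "K + D < W"
    and marks: "\<And>v. v \<in> nodes N \<Longrightarrow>
      marking K D (peak K (window_colour K t (\<lambda>i. fst (ancestor w N i v))))"
  shows "correct_labeling P N (\<lambda>v. ancestor_label F \<sigma>0 K W t (\<lambda>i. ancestor w N i v))"
  unfolding correct_labeling_def
proof (intro conjI ballI impI)
  have ar: "1 \<le> arity P"
    using lcl by (simp add: lcl_problem_def)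
  have idx: "snd (ancestor w N i v) < arity P" if "v \<in> nodes N" for v i
    using ancestor_index[OF N ar that] .
  fix v assume v: "v \<in> nodes N"
  show "ancestor_label F \<sigma>0 K W t (\<lambda>i. ancestor w N i v) \<in> labels P"
    unfolding ancestor_label_def
    by (rule mark_label_in_labels[OF marks[OF v] W]) (rule idx[OF v])
  assume card: "card (children N v) = arity P"
  obtain h where h: "inj_on h {..<arity P}" "h ` {..<arity P} = children N v"
    "\<And>c. c < arity P \<Longrightarrow> index_in_parent N (h c) = c"
    using children_by_index[OF N(1) v] card by metis
  have hc: "h c \<in> children N v" "h c \<in> nodes N" if "c < arity P" for c
    using h(2) that by (auto intro: childrenD(1))
  have up: "ancestor w N (Suc i) (h c) = ancestor w N i v" if "c < arity P" for c i
    by (rule ancestor_child[OF hc(1)[OF that]])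
  have "allowed P (ancestor_label F \<sigma>0 K W t (\<lambda>i. ancestor w N i v))
      (map (\<lambda>c. ancestor_label F \<sigma>0 K W t (\<lambda>i. ancestor w N i (h c))) [0..<arity P])"
    unfolding ancestor_label_def
  proof (rule mark_label_allowed[OF marks[OF v] W idx[OF v]])
    fix c i assume c: "c < arity P"
    show "marking K D (peak K (window_colour K t (\<lambda>i. fst (ancestor w N i (h c)))))"
      by (rule marks[OF hc(2)[OF c]])
    show "peak K (window_colour K t (\<lambda>i. fst (ancestor w N i (h c)))) (Suc i)
        = peak K (window_colour K t (\<lambda>i. fst (ancestor w N i v))) i" if "K \<le> i"
      by (rule peak_window_colour_Suc[OF _ that]) (simp only: up[OF c])
    show "snd (ancestor w N (Suc i) (h c)) = snd (ancestor w N i v)"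
      by (simp only: up[OF c])
    show "snd (ancestor w N 0 (h c)) = c"
      by (simp add: h(3)[OF c])
  qed
  then have al: "allowed P (ancestor_label F \<sigma>0 K W t (\<lambda>i. ancestor w N i v))
      (map (\<lambda>u. ancestor_label F \<sigma>0 K W t (\<lambda>i. ancestor w N i u)) (map h [0..<arity P]))"
    by (simp add: comp_def)
  have dist: "distinct (map h [0..<arity P])"
    using h(1) by (simp add: distinct_map atLeast0LessThan)
  have set: "set (map h [0..<arity P]) = children N v"
    using h(2) by (simp add: atLeast0LessThan)
  show "\<exists>vs. distinct vs \<and> set vs = children N v \<and>
      (ancestor_label F \<sigma>0 K W t (\<lambda>i. ancestor w N i v),
       map (\<lambda>u. ancestor_label F \<sigma>0 K W t (\<lambda>i. ancestor w N i u)) vs) \<in> configs P"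
    using allowed_map_distinct[OF al dist] unfolding set .
qed

end

lemma correct_labeling_cong:
  assumes "\<And>v. v \<in> nodes T \<Longrightarrow> L v = L' v" "correct_labeling P T L'"
  shows "correct_labeling P T L"
  unfolding correct_labeling_def
proof (intro conjI ballI impI)
  fix v assume v: "v \<in> nodes T"
  then show "L v \<in> labels P"
    using assms by (simp add: correct_labeling_def)
  assume "card (children T v) = arity P"
  then obtain vs where vs: "distinct vs" "set vs = children T v" "(L' v, map L' vs) \<in> configs P"
    using assms(2) v by (auto simp: correct_labeling_def)
  have "map L vs = map L' vs"
    using vs(2) by (intro map_cong refl assms(1)) (auto intro: childrenD(1))
  then show "\<exists>vs. distinct vs \<and> set vs = children T v \<and> (L v, map L vs) \<in> configs P"
    using vs assms(1)[OF v] by metis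
qed

section \<open>Growth of identifiers, rounds and message lengths\<close>

lemma poly_nat_bound:
  fixes p :: "nat poly"
  shows "\<exists>a c. \<forall>n \<ge> 1. poly p n \<le> a * n ^ c"
proof -
  have "poly p n \<le> (\<Sum>i\<le>degree p. coeff p i) * n ^ degree p" if "1 \<le> n" for n
    unfolding poly_altdef sum_distrib_right
    using that by (intro sum_mono mult_le_mono2 power_increasing) auto
  then show ?thesis
    by blast
qed

text \<open>For \<open>n > 1\<close> the value of \<open>log_star\<close> is at least
  \<open>1\<close> and absorbs the additive constant.\<close>

lemma const_plus_log_star_bigo:
  "(\<lambda>n. real (C + K * log_star (real n))) \<in> O(\<lambda>n. real (log_star (real n)))"
proof (rule bigoI[where c = "real C + real K"])
  show "\<forall>\<^sub>F n in sequentially. norm (real (C + K * log_star (real n)))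
      \<le> (real C + real K) * norm (real (log_star (real n)))"
    using eventually_gt_at_top[of 1]
  proof eventually_elim
    case (elim n)
    then have "1 \<le> log_star (real n)"
      by (intro log_star_ge_1) simp
    then have "real C * 1 \<le> real C * real (log_star (real n))"
      by (intro mult_left_mono) auto
    then show ?case
      by (simp add: distrib_right)
  qed
qed

lemma ceiling_log_bigo:
  assumes "0 \<le> B" "0 \<le> c"
  shows "(\<lambda>n. real (nat \<lceil>B + c * log 2 (real n)\<rceil>)) \<in> O(\<lambda>n. ln (real n))"
proof (rule bigoI[where c = "B + 1 + c / ln 2"])
  show "\<forall>\<^sub>F n in sequentially. norm (real (nat \<lceil>B + c * log 2 (real n)\<rceil>))
      \<le> (B + 1 + c / ln 2) * norm (ln (real n))"
    using eventually_ge_at_top[of 3]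
  proof eventually_elim
    case (elim n)
    have ln: "1 \<le> ln (real n)"
      using elim exp_le by (subst ln_ge_iff) auto
    have nonneg: "0 \<le> B + c * log 2 (real n)"
      using assms elim by simp
    then have "real (nat \<lceil>B + c * log 2 (real n)\<rceil>) \<le> B + c * log 2 (real n) + 1"
      by linarith
    also have "\<dots> \<le> (B + 1) * ln (real n) + c / ln 2 * ln (real n)"
      using assms ln mult_left_mono[of 1 "ln (real n)" "B + 1"] by (simp add: log_def)
    finally show ?case
      using ln by (simp add: distrib_right)
  qed
qed

context uniform_blocks
begin

lemma congest_solvable_log_star: "congest_solvable P (\<lambda>n. real (log_star (real n)))"
  unfolding congest_solvable_def
proof
  fix p :: "nat poly"
  have ar: "1 \<le> arity P"
    using lcl by (simp add: lcl_problem_def)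
  obtain a c where ac: "\<And>n. 1 \<le> n \<Longrightarrow> poly p n \<le> a * n ^ c"
    using poly_nat_bound by blast
  \<comment> \<open>Adding \<open>K + 1\<close> makes \<open>X n\<close> bound the virtual
    identifiers too.\<close>
  define a' where "a' = real (a + K + 1)"
  define X where "X n = a' * real n ^ c" for n
  have a': "1 \<le> a'"
    by (simp add: a'_def)
  have X: "real (poly p n + K + 1) \<le> X n" "1 \<le> X n" "log 2 (X n) = log 2 a' + real c * log 2 (real n)"
    if n: "1 \<le> n" for n
  proof -
    have pow: "1 \<le> real n ^ c"
      using n by simp
    have "(K + 1) * 1 \<le> (K + 1) * n ^ c"
      using n by (intro mult_le_mono2) simp
    then have "poly p n + K + 1 \<le> a * n ^ c + (K + 1) * n ^ c"
      using ac[OF n] by simp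
    also have "\<dots> = (a + K + 1) * n ^ c"
      by (simp add: algebra_simps)
    finally have "real (poly p n + K + 1) \<le> real ((a + K + 1) * n ^ c)"
      by (rule of_nat_mono)
    then show "real (poly p n + K + 1) \<le> X n"
      by (simp only: X_def a'_def of_nat_mult of_nat_power)
    show "1 \<le> X n"
      unfolding X_def using a' pow mult_mono[of 1 a' 1 "real n ^ c"] by simp
    show "log 2 (X n) = log 2 a' + real c * log 2 (real n)"
      using a' n by (simp add: X_def log_mult log_nat_power)
  qed
  \<comment> \<open>\<open>16\<close> is what \<open>twice_log2_add_3\<close> asks for; the other
    bound yields \<open>AX\<close>, by which one step brings all colours down to
    \<open>A * n\<close>.\<close>
  obtain A :: nat where A: "max 16 (2 * log 2 a' + 2 * real c + 1) \<le> real A"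
    using real_arch_simple by blast
  have A16: "16 \<le> real A" and A': "2 * log 2 a' + 2 * real c + 1 \<le> real A"
    using A by auto
  have AX: "2 * log 2 (X n) + 1 \<le> real A * real n" if n: "1 \<le> n" for n
  proof -
    have "log 2 (real n) \<le> real n"
    proof (cases "2 \<le> real n")
      case True
      then show ?thesis
        using log2_le_minus_1[OF True] by simp
    next
      case False
      then show ?thesis
        using n by (cases "n = 1") auto
    qed
    then have "real c * log 2 (real n) \<le> real c * real n"
      by (intro mult_left_mono) auto
    moreover have "(2 * log 2 a' + 1) * 1 \<le> (2 * log 2 a' + 1) * real n"
      using a' n by (intro mult_left_mono) auto
    moreover have "(2 * log 2 a' + 2 * real c + 1) * real n \<le> real A * real n"
      using A' by (intro mult_right_mono) auto
    ultimately show ?thesis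
      unfolding X(3)[OF n] by (simp add: algebra_simps)
  qed
  obtain Q where Q: "\<And>t x i. (\<forall>j. 1 \<le> j \<longrightarrow> j \<le> K \<longrightarrow> colour j t x i \<le> A) \<Longrightarrow> window_colour K t x i \<le> Q"
    using window_colour_bound by blast
  \<comment> \<open>\<open>D\<close> comes from \<open>marking_peak\<close>, and \<open>W\<close> is
    the least value above \<open>K + D\<close>. Like \<open>A\<close> and \<open>Q\<close> they do
    not depend on \<open>n\<close>, so \<open>R n\<close> grows only through
    \<open>K * t n\<close>.\<close>
  define D where "D = 2 * K * Q"
  define W where "W = Suc (K + D)"
  define t where "t n = Suc (log_star (real n))" for n
  define R where "R n = W + 2 * D + 2 + K + K * t n" for n
  define w where "w n = virtual_id K (poly p n)" for n
  \<comment> \<open>The bound of \<open>length_encode\<close> without the part growing with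
    \<open>n\<close>.\<close>
  define B where "B = real (arity P) + 2 + log 2 a'"
  define b where "b n = nat \<lceil>B + real c * log 2 (real n)\<rceil>" for n
  define alg where "alg = collecting w R (\<lambda>n. ancestor_label F \<sigma>0 K W (t n))"
  have "0 \<le> B"
    using a' by (simp add: B_def)
  have rounds: "(\<lambda>n. real (R n)) \<in> O(\<lambda>n. real (log_star (real n)))"
    using const_plus_log_star_bigo[of "W + 2 * D + 2 + K + K" K]
    by (simp add: R_def t_def algebra_simps)
  have bits: "(\<lambda>n. real (b n)) \<in> O(\<lambda>n. ln (real n))"
    unfolding b_def using \<open>0 \<le> B\<close> by (intro ceiling_log_bigo) auto
  have "terminates_within alg N (R (card (nodes N))) \<and>
      message_size_bounded alg N (b (card (nodes N))) \<and>
      correct_labeling P N (output_label alg N)"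
    if N: "valid_network p N" "full_tree (arity P) N" for N :: "nat network"
  proof (intro conjI)
    let ?n = "card (nodes N)"
    have rt: "rooted_tree N"
      using N by (simp add: full_tree_def)
    have n: "1 \<le> ?n"
      using rt by (auto simp: rooted_tree_def Suc_le_eq card_gt_0_iff)
    show "terminates_within alg N (R ?n)"
      unfolding alg_def by (rule collecting_terminates)
    have "real (arity P) + 2 + log 2 (X ?n) \<le> real (b ?n)"
      using of_nat_ceiling[of "B + real c * log 2 (real ?n)"] X(3)[OF n] by (simp add: b_def B_def)
    then show "message_size_bounded alg N (b ?n)"
      unfolding alg_def
      by (intro collecting_message_size[OF N ar _ X(1,2)[OF n]]) (simp_all add: w_def)
    have marks: "marking K D (peak K (window_colour K (t ?n) (\<lambda>i. fst (ancestor (w ?n) N i v))))"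
      if v: "v \<in> nodes N" for v
    proof -
      let ?x = "\<lambda>i. fst (ancestor (w ?n) N i v)"
      have neq: "?x i \<noteq> ?x (i + j)" if "1 \<le> j" "j \<le> K" for i j
        unfolding w_def by (rule ancestor_id_neq[OF N(1) v refl that])
      have xX: "real (?x i) \<le> X ?n" for i
        using ancestor_id_le[OF N(1) v refl, of K i] X(1)[OF n] unfolding w_def
        by (meson of_nat_le_iff order_trans)
      have "colour j (t ?n) ?x i \<le> A" if "1 \<le> j" "j \<le> K" for i j
      proof -
        have "real (colour j (Suc (log_star (real ?n))) ?x i) \<le> real A"
          by (rule colour_log_star[where X = "X ?n", OF _ _ A16 AX[OF n]]) (rule neq[OF that] xX)+
        then show ?thesis
          by (simp add: t_def)
      qed
      then have le: "window_colour K (t ?n) ?x i \<le> Q" for i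
        using Q by blast
      show ?thesis
        unfolding D_def
      proof (rule marking_peak[OF le])
        fix i j :: nat assume "1 \<le> j" "j \<le> K"
        then show "window_colour K (t ?n) ?x i \<noteq> window_colour K (t ?n) ?x (i + j)"
          by (intro window_colour_neq neq)
      qed
    qed
    have label: "output_label alg N v
        = ancestor_label F \<sigma>0 K W (t ?n) (\<lambda>i. ancestor (w ?n) N i v)" if v: "v \<in> nodes N" for v
    proof -
      have "gathered (w ?n) (state_after alg N (R ?n) v) i = ancestor (w ?n) N i v"
        if "i < W + 2 * D + 2 + K + K * t ?n" for i
        unfolding alg_def using that by (intro gathered_collecting[OF N(1) v]) (simp add: R_def)
      then have "ancestor_label F \<sigma>0 K W (t ?n) (\<lambda>i. ancestor (w ?n) N i v)
          = ancestor_label F \<sigma>0 K W (t ?n) (gathered (w ?n) (state_after alg N (R ?n) v))"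
        by (intro ancestor_label_cong[OF marks[OF v]]) (simp_all add: W_def)
      then show ?thesis
        unfolding alg_def collecting_output_label by simp
    qed
    have "correct_labeling P N
        (\<lambda>v. ancestor_label F \<sigma>0 K W (t ?n) (\<lambda>i. ancestor (w ?n) N i v))"
      by (rule correct_ancestor_labeling[OF N _ marks]) (simp_all add: W_def)
    then show "correct_labeling P N (output_label alg N)"
      by (rule correct_labeling_cong[rotated]) (simp add: label)
  qed
  then show "\<exists>(A :: 'l algorithm) rounds bits.
      (\<lambda>n. real (rounds n)) \<in> O(\<lambda>n. real (log_star (real n))) \<and>
      (\<lambda>n. real (bits n)) \<in> O(\<lambda>n. ln (real n)) \<and>
      (\<forall>N :: nat network. valid_network p N \<and> full_tree (arity P) N \<longrightarrow>
         terminates_within A N (rounds (card (nodes N))) \<and>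
         message_size_bounded A N (bits (card (nodes N))) \<and>
         correct_labeling P N (output_label A N))"
    using rounds bits by blast
qed

end

theorem theorem6p3:
  fixes P :: "'l lcl"
  assumes "lcl_problem P"
    and "(\<exists>S d T L. uniform_certificate P S d T L) \<or>
         (\<exists>S d1 d2 T1 L1 T2 L2. coprime_certificate P S d1 d2 T1 L1 T2 L2)"
  shows "congest_solvable P (\<lambda>n. real (log_star (real n)))"
proof -
  obtain S K F where S: "S \<noteq> {}" "S \<subseteq> labels P" "K \<ge> 1"
    and F: "\<And>k. K \<le> k \<Longrightarrow> uniform_block P S k (F k)"
    using uniform_blocks_exist[OF assms] by blast
  obtain \<sigma>0 where "\<sigma>0 \<in> S"
    using S(1) by blast
  then interpret uniform_blocks P S K F \<sigma>0
    using assms(1) S F by unfold_locales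
  show ?thesis
    by (rule congest_solvable_log_star)
qed

end
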